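(* Let $t\le T-1$. Suppose that the enlarged market satisfies $\hat C_u\le C_u$ for all $u\le T$, and that $\hat C$ is positively super $\delta$-homogeneous and is either sub-additive or super-additive in its second variable. Suppose that there exists an $\mathcal F_{t+1}$-normal integrand $\tilde\gamma_{t+1}^{\xi}$ defined on $\mathbb R^m\times\mathbb R^d$ (i.e. on $\Omega\times\mathbb R^m\times\mathbb R^d$) such that $\gamma_{t+1}^{\xi}(V_t)=\tilde\gamma_{t+1}^{\xi}(S_{t+1},V_t)$ for all $V_t\in L^0(\mathbb R^d,\mathcal F_t)$. Assume that: (a) $\xi=g(S_T)$ where $g$ is continuous with values in $\mathbb R^d_+$, and $\xi$ is hedgeable; (b) for each $u\le T-1$, $\operatorname{supp}_{\mathcal F_u}S_{u+1}=\phi_u(S_u)$, where $\phi_u$ is a lower hemicontinuous set-valued function on $\mathbb R^m$ with compact values such that $\phi_u(S_u)\subseteq\bar B(0,R_u(S_u))$ for a continuous function $R_u$ on $\mathbb R^m$. Suppose that $C_t(s,z)$ is an $\mathcal F_t$-normal integrand and that $C_t$ is either super-additive or sub-additive in $z$. Then, if $\inf_{z\in S^{d-1}(0,1)}\hat D_t^0(S_t,0,z)>0$ a.s., we have $\gamma_t^{\xi}(V_{t-1})=\tilde\gamma_t^{\xi}(S_t,V_{t-1})$ a.s. for all $V_{t-1}\in L^0(\mathbb R^d,\mathcal F_t)$, where $\tilde\gamma_t^{\xi}(s,v_{t-1})$ is an $\mathcal F_t$-normal integrand.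
   Context: Setting. $(\Omega,(\mathcal F_t)_{t=0}^T,P)$ is a discrete-time stochastic basis with complete filtration ($\mathcal F_0$ contains the $P$-null sets); $\mathcal F_{-1}:=\mathcal F_0$. For a (random) set $A\subseteq\mathbb R^k$, $L^0(A,\mathcal F_t)$ is the set of (classes of) $\mathcal F_t$-measurable random variables $X$ with $X\in A$ a.s. For $z\in\mathbb R^d$ write $z=(z^1,z^{(2)})$ with $z^{(2)}=(z^2,\dots,z^d)$, and $e_1=(1,0,\dots,0)$. $\bar B(0,r)$ is the closed ball and $S^{d-1}(0,1):=\{z\in\mathbb R^d:z^1=0,\ |z|=1\}$. For a family of random variables, $\operatorname{ess\,sup}_{\mathcal F_t}$ (resp. $\operatorname{ess\,inf}_{\mathcal F_t}$) is the smallest (resp. largest) $\mathcal F_t$-measurable $[-\infty,\infty]$-valued random variable which a.s. dominates (resp. is a.s. dominated by) every member; for a single random variable $X$ it is that of $\{X\}$. An $\mathcal F$-normal integrand is an (extended real-valued) function $f(\omega,x)$ on $\Omega\times\mathbb R^k$ that is $\mathcal F\otimes\mathcal B(\mathbb R^k)$-measurable and lower semicontinuous in $x$; $f(Z)$ denotes $\omega\mapsto f(\omega,Z(\omega))$. $\operatorname{supp}_{\mathcal F_t}S_{t+1}$ (conditional support) is the smallest $\mathcal F_t$-measurable random closed set containing $S_{t+1}$ a.s. Market. $S_t$ is an $\mathcal F_t$-measurable $\mathbb R^m_+$-valued random variable ($m\ge d\ge 1$). For $t\le T$ the cost function $C_t:\mathbb R^m\times\mathbb R^d\to\mathbb R$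 is Borel and lower semicontinuous and satisfies: $C_t(s,0)=0$ for $s\in\mathbb R^m_+$; $C_t(s,x+\lambda e_1)=C_t(s,x)+\lambda$ for $\lambda\in\mathbb R$; $C_T(s,x_2)\ge C_T(s,x_1)$ whenever $x_2-x_1\in\mathbb R^d_+$; $|C_t(s,x)|\le h_t(s,x)$ for a deterministic continuous function $h_t$. One writes $C_t(x)=C_t(S_t,x)$. The solvency sets are $G_t=\{z\in\mathbb R^d: -C_t(-z)\ge 0\}$; they are closed, graph-measurable w.r.t. $\mathcal F_t$, satisfy $G_t+\mathbb R^d_+\subseteq G_t$, $-e_1\notin G_t$, and $C_t(z)=\min\{\alpha\in\mathbb R:\alpha e_1-z\in G_t\}$. A portfolio process is an adapted $\mathbb R^d$-valued process $V$ with $V_{-1}\in\mathbb R e_1$ and $V_t-V_{t-1}\in -G_t$ a.s. for $t=0,\dots,T$. The payoff $\xi$ is hedgeable if there is a portfolio process $V^\xi$ with $V_T^\xi=\xi$. Hedging costs. For $\xi\in L^0(\mathbb R^d,\mathcal F_T)$, $0\le t\le T$ and $V_{t-1}\in L^0(\mathbb R^d,\mathcal F_t)$, $$\gamma_t^{\xi}(V_{t-1}):=\operatorname*{ess\,inf}_{V^{(2)}\in\Pi_t^T(V_{t-1},\xi)}{}_{\mathcal F_t}\ \operatorname{ess\,sup}_{\mathcal F_t}\Big(\xi^1+\sum_{s=t}^T C_s\big(0,V_s^{(2)}-V_{s-1}^{(2)}\big)\Big),$$ where $\Pi_t^T(V_{t-1},\xi)$ is the set of families $(V_s^{(2)})_{s=t-1}^T$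 whose entry at $t-1$ is the given $V_{t-1}^{(2)}$, with $V_s^{(2)}\in L^0(\mathbb R^{d-1},\mathcal F_s)$ for $s=t,\dots,T-1$ and $V_T^{(2)}=\xi^{(2)}$. Enlarged market. The horizon cost function is $\hat C_t(s,y):=\liminf_{\alpha\to\infty}C_t(s,\alpha y)/\alpha$. For a payoff $\xi=g(S_T)$, with $g=(g^1,g^{(2)})$, set $\hat\gamma_T^\xi(V_{T-1})=\hat\gamma_T^\xi(S_T,V_{T-1}):=g^1(S_T)+\hat C_T(S_T,(0,g^{(2)}(S_T)-V_{T-1}^{(2)}))$ and recursively, for $t\le T-1$, $\hat\theta_t^\xi(V_t):=\operatorname{ess\,sup}_{\mathcal F_t}\hat\gamma_{t+1}^\xi(V_t)$, $\hat D_t^\xi(S_t,V_{t-1},V_t):=\hat C_t(S_t,(0,V_t^{(2)}-V_{t-1}^{(2)}))+\hat\theta_t^\xi(V_t)$, $\hat\gamma_t^\xi(V_{t-1}):=\operatorname{ess\,inf}_{\mathcal F_t}\{\hat D_t^\xi(S_t,V_{t-1},V_t):V_t\in L^0(\mathbb R^d,\mathcal F_t)\}$. Superscript $0$ means $g=0$. When $\hat D_t^0(S_t,0,z)$ is evaluated at deterministic $z$, $\hat\theta_t^0$ is identified with an $\mathcal F_t$-normal integrand on $\Omega\times\mathbb R^d$ agreeing with it a.s. at every $V\in L^0(\mathbb R^d,\mathcal F_t)$. Super $\delta$-homogeneity: $\delta$ is an increasing bijection of $[0,+\infty]$ with $\delta(0)=0$, $\delta(\infty)=\infty$, and $\hat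 C$ is positively super $\delta$-homogeneous if, for every $t\le T$, $\hat C_t(s,\lambda x)\ge\delta(\lambda)\hat C_t(s,x)$ for all $\lambda\ge1$, $s\in\mathbb R^m_+$, $x\in\mathbb R^d$. *)

theory Defs
  imports "HOL-Probability.Probability"
begin

section \<open>Essential extrema with respect to a sub-sigma-algebra\<close>

definition is_ess_sup ::
  "'a measure \<Rightarrow> 'a measure \<Rightarrow> ('a \<Rightarrow> ereal) set \<Rightarrow> ('a \<Rightarrow> ereal) \<Rightarrow> bool" where
  "is_ess_sup M G Xs Y \<longleftrightarrow>
     Y \<in> borel_measurable G \<and> (\<forall>X\<in>Xs. AE \<omega> in M. X \<omega> \<le> Y \<omega>) \<and>
     (\<forall>Y'\<in>borel_measurable G. (\<forall>X\<in>Xs. AE \<omega> in M. X \<omega> \<le> Y' \<omega>) \<longrightarrow> (AE \<omega> in M. Y \<omega> \<le> Y' \<omega>))"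

definition is_ess_inf ::
  "'a measure \<Rightarrow> 'a measure \<Rightarrow> ('a \<Rightarrow> ereal) set \<Rightarrow> ('a \<Rightarrow> ereal) \<Rightarrow> bool" where
  "is_ess_inf M G Xs Y \<longleftrightarrow>
     Y \<in> borel_measurable G \<and> (\<forall>X\<in>Xs. AE \<omega> in M. Y \<omega> \<le> X \<omega>) \<and>
     (\<forall>Y'\<in>borel_measurable G. (\<forall>X\<in>Xs. AE \<omega> in M. Y' \<omega> \<le> X \<omega>) \<longrightarrow> (AE \<omega> in M. Y' \<omega> \<le> Y \<omega>))"

text \<open>Random variables are functions rather than classes, so the following two constants are
  arbitrary versions of the essential extrema.  These exist for every family of functions
  (lemmas \<open>ess_sup_is_ess_sup\<close> and \<open>ess_inf_is_ess_inf\<close> below) and are unique up to null sets.\<close>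

definition ess_sup :: "'a measure \<Rightarrow> 'a measure \<Rightarrow> ('a \<Rightarrow> ereal) set \<Rightarrow> 'a \<Rightarrow> ereal" where
  "ess_sup M G Xs = (SOME Y. is_ess_sup M G Xs Y)"

definition ess_inf :: "'a measure \<Rightarrow> 'a measure \<Rightarrow> ('a \<Rightarrow> ereal) set \<Rightarrow> 'a \<Rightarrow> ereal" where
  "ess_inf M G Xs = (SOME Y. is_ess_inf M G Xs Y)"

definition ereal_arctan :: "ereal \<Rightarrow> real" where
  "ereal_arctan x = (if x = \<infinity> then pi/2 else if x = -\<infinity> then -pi/2 else arctan (real_of_ereal x))"

lemma ereal_arctan_less: "x < y \<Longrightarrow> ereal_arctan x < ereal_arctan y"
  using arctan_lbound arctan_ubound pi_gt_zero
  by (cases x; cases y) (simp_all add: ereal_arctan_def arctan_less_iff)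

lemma ereal_arctan_le_iff: "ereal_arctan x \<le> ereal_arctan y \<longleftrightarrow> x \<le> y"
  by (metis ereal_arctan_less linorder_not_less order_le_less)

lemma ereal_arctan_bound: "\<bar>ereal_arctan x\<bar> \<le> pi/2"
  using arctan_bounded[of "real_of_ereal x"] by (auto simp: ereal_arctan_def abs_le_iff)

lemma ereal_arctan_measurable [measurable]: "ereal_arctan \<in> borel_measurable borel"
  unfolding ereal_arctan_def[abs_def] by measurable

lemma is_ess_sup_exists:
  assumes "prob_space M" and sub: "subalgebra M G"
  shows "\<exists>Y. is_ess_sup M G Xs Y"
proof -
  interpret prob_space M by fact
  define U where "U = {Y \<in> borel_measurable G. \<forall>X\<in>Xs. AE \<omega> in M. X \<omega> \<le> Y \<omega>}"
  define J where "J Y = (\<integral>\<omega>. ereal_arctan (Y \<omega>) \<partial>M)" for Y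
  have UM: "Y \<in> borel_measurable M" if "Y \<in> U" for Y
    using that sub measurable_from_subalg by (auto simp: U_def)
  have int: "integrable M (\<lambda>\<omega>. ereal_arctan (Y \<omega>))" if "Y \<in> U" for Y
  proof (rule integrable_const_bound[where B="pi/2"])
    show "AE \<omega> in M. norm (ereal_arctan (Y \<omega>)) \<le> pi/2"
      using ereal_arctan_bound by (intro AE_I2) (simp only: real_norm_def)
  qed (use UM[OF that] in measurable)
  have top: "(\<lambda>_. \<infinity>) \<in> U" by (auto simp: U_def)
  have bdd: "bdd_below (J ` U)"
  proof (rule bdd_belowI2[where m="-(pi/2)"])
    fix Y assume "Y \<in> U"
    have "(\<integral>\<omega>. -(pi/2) \<partial>M) \<le> J Y" unfolding J_def
    proof (rule integral_mono)
      show "-(pi/2) \<le> ereal_arctan (Y \<omega>)" for \<omega>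
        using ereal_arctan_bound[of "Y \<omega>"] by linarith
    qed (auto simp: int \<open>Y \<in> U\<close>)
    then show "-(pi/2) \<le> J Y" by (simp add: prob_space)
  qed
  have "\<exists>Y\<in>U. J Y < Inf (J ` U) + inverse (real (Suc n))" for n
  proof -
    have "Inf (J ` U) < Inf (J ` U) + inverse (real (Suc n))" by simp
    then show ?thesis using top bdd by (subst (asm) cInf_less_iff) auto
  qed
  then obtain y where y: "\<And>n. y n \<in> U" "\<And>n. J (y n) < Inf (J ` U) + inverse (real (Suc n))"
    by metis
  define Y where "Y \<omega> = (INF n. y n \<omega>)" for \<omega>
  have YU: "Y \<in> U"
  proof -
    have [measurable]: "y n \<in> borel_measurable G" for n using y(1)[of n] by (simp add: U_def)
    have "Y \<in> borel_measurable G" unfolding Y_def by measurable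
    moreover have "AE \<omega> in M. X \<omega> \<le> Y \<omega>" if "X \<in> Xs" for X
    proof -
      have "AE \<omega> in M. \<forall>n. X \<omega> \<le> y n \<omega>" using y(1) that by (auto simp: U_def AE_all_countable)
      then show ?thesis by eventually_elim (auto simp: Y_def intro: INF_greatest)
    qed
    ultimately show ?thesis by (auto simp: U_def)
  qed
  have JY: "J Y \<le> Inf (J ` U)"
  proof (rule LIMSEQ_le_const)
    show "(\<lambda>n. Inf (J ` U) + inverse (real (Suc n))) \<longlonglongrightarrow> Inf (J ` U)"
      using LIMSEQ_inverse_real_of_nat_add by blast
    have "J Y \<le> J (y n)" for n unfolding J_def
      by (intro integral_mono int YU y(1)) (auto simp: ereal_arctan_le_iff Y_def intro: INF_lower)
    then show "\<exists>N. \<forall>n\<ge>N. J Y \<le> Inf (J ` U) + inverse (real (Suc n))"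
      using y(2) by (meson less_imp_le order_trans)
  qed
  have "AE \<omega> in M. Y \<omega> \<le> Y' \<omega>" if "Y' \<in> U" for Y'
  proof -
    define Z where "Z \<omega> = min (Y \<omega>) (Y' \<omega>)" for \<omega>
    have ZU: "Z \<in> U"
      using YU that unfolding U_def Z_def by auto
    have "J Y \<le> J Z" using JY ZU bdd by (meson cINF_lower order_trans)
    then have "(\<integral>\<omega>. ereal_arctan (Y \<omega>) - ereal_arctan (Z \<omega>) \<partial>M) \<le> 0"
      unfolding J_def by (subst Bochner_Integration.integral_diff) (auto simp: int YU ZU)
    moreover have nn: "AE \<omega> in M. 0 \<le> ereal_arctan (Y \<omega>) - ereal_arctan (Z \<omega>)"
      by (auto simp: ereal_arctan_le_iff Z_def)
    ultimately have "(\<integral>\<omega>. ereal_arctan (Y \<omega>) - ereal_arctan (Z \<omega>) \<partial>M) = 0"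
      using integral_nonneg_AE[OF nn] by linarith
    then have "AE \<omega> in M. ereal_arctan (Y \<omega>) - ereal_arctan (Z \<omega>) = 0"
      using nn int YU ZU by (subst (asm) integral_nonneg_eq_0_iff_AE) auto
    then show ?thesis
    proof eventually_elim
      case (elim \<omega>)
      then have "Y \<omega> \<le> Z \<omega>" by (simp add: ereal_arctan_le_iff[symmetric])
      then show ?case by (simp add: Z_def)
    qed
  qed
  with YU show ?thesis unfolding is_ess_sup_def U_def by blast
qed

lemma is_ess_inf_exists:
  assumes "prob_space M" and "subalgebra M G"
  shows "\<exists>Y. is_ess_inf M G Xs Y"
proof -
  obtain Y where Y: "is_ess_sup M G ((\<lambda>X \<omega>. - X \<omega>) ` Xs) Y"
    using is_ess_sup_exists[OF assms] by blast
  have "is_ess_inf M G Xs (\<lambda>\<omega>. - Y \<omega>)"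
    unfolding is_ess_inf_def
  proof (intro conjI ballI impI)
    show "(\<lambda>\<omega>. - Y \<omega>) \<in> borel_measurable G" using Y by (auto simp: is_ess_sup_def)
    show "AE \<omega> in M. - Y \<omega> \<le> X \<omega>" if "X \<in> Xs" for X
    proof -
      have "AE \<omega> in M. - X \<omega> \<le> Y \<omega>" using Y that by (auto simp: is_ess_sup_def)
      then show ?thesis by eventually_elim (subst ereal_uminus_le_reorder)
    qed
    fix Y' assume Y': "Y' \<in> borel_measurable G" "\<forall>X\<in>Xs. AE \<omega> in M. Y' \<omega> \<le> X \<omega>"
    then have "AE \<omega> in M. Y \<omega> \<le> - Y' \<omega>"
      using Y unfolding is_ess_sup_def by (auto dest!: bspec[where x="\<lambda>\<omega>. - Y' \<omega>"])
    then show "AE \<omega> in M. Y' \<omega> \<le> - Y \<omega>"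
      by eventually_elim (metis ereal_minus_le_minus ereal_uminus_uminus)
  qed
  then show ?thesis by blast
qed

lemma ess_sup_is_ess_sup:
  "prob_space M \<Longrightarrow> subalgebra M G \<Longrightarrow> is_ess_sup M G Xs (ess_sup M G Xs)"
  unfolding ess_sup_def by (rule someI_ex[OF is_ess_sup_exists])

lemma ess_inf_is_ess_inf:
  "prob_space M \<Longrightarrow> subalgebra M G \<Longrightarrow> is_ess_inf M G Xs (ess_inf M G Xs)"
  unfolding ess_inf_def by (rule someI_ex[OF is_ess_inf_exists])


section \<open>Semicontinuity, normal integrands and conditional supports\<close>

definition lsc :: "('b::topological_space \<Rightarrow> ereal) \<Rightarrow> bool" where
  "lsc f \<longleftrightarrow> (\<forall>x c. c < f x \<longrightarrow> (\<forall>\<^sub>F y in nhds x. c < f y))"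

definition normal_integrand ::
  "'a measure \<Rightarrow> ('a \<Rightarrow> 'b::topological_space \<Rightarrow> ereal) \<Rightarrow> bool" where
  "normal_integrand G f \<longleftrightarrow>
     (\<lambda>(\<omega>, x). f \<omega> x) \<in> borel_measurable (G \<Otimes>\<^sub>M borel) \<and> (\<forall>\<omega>\<in>space G. lsc (f \<omega>))"

definition lower_hemicontinuous ::
  "('b::topological_space \<Rightarrow> 'c::topological_space set) \<Rightarrow> bool" where
  "lower_hemicontinuous \<phi> \<longleftrightarrow> (\<forall>U. open U \<longrightarrow> open {s. \<phi> s \<inter> U \<noteq> {}})"

definition random_closed_set ::
  "'a measure \<Rightarrow> ('a \<Rightarrow> 'b::topological_space set) \<Rightarrow> bool" where
  "random_closed_set G \<Gamma> \<longleftrightarrow>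
     (\<forall>\<omega>\<in>space G. closed (\<Gamma> \<omega>)) \<and>
     (\<forall>U. open U \<longrightarrow> {\<omega>\<in>space G. \<Gamma> \<omega> \<inter> U \<noteq> {}} \<in> sets G)"

definition is_cond_support ::
  "'a measure \<Rightarrow> 'a measure \<Rightarrow> ('a \<Rightarrow> 'b::topological_space) \<Rightarrow> ('a \<Rightarrow> 'b set) \<Rightarrow> bool" where
  "is_cond_support M G X \<Gamma> \<longleftrightarrow>
     random_closed_set G \<Gamma> \<and> (AE \<omega> in M. X \<omega> \<in> \<Gamma> \<omega>) \<and>
     (\<forall>\<Gamma>'. random_closed_set G \<Gamma>' \<and> (AE \<omega> in M. X \<omega> \<in> \<Gamma>' \<omega>) \<longrightarrow> (AE \<omega> in M. \<Gamma> \<omega> \<subseteq> \<Gamma>' \<omega>))"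


section \<open>Additivity and homogeneity of cost functions\<close>

text \<open>The inequalities are imposed for price vectors in the closed positive orthant.\<close>

definition sub_additive_cost :: "(real^'m \<Rightarrow> real^'d \<Rightarrow> ereal) \<Rightarrow> bool" where
  "sub_additive_cost c \<longleftrightarrow> (\<forall>s\<ge>0. \<forall>x y. c s (x + y) \<le> c s x + c s y)"

definition super_additive_cost :: "(real^'m \<Rightarrow> real^'d \<Rightarrow> ereal) \<Rightarrow> bool" where
  "super_additive_cost c \<longleftrightarrow> (\<forall>s\<ge>0. \<forall>x y. c s (x + y) \<ge> c s x + c s y)"

definition super_homogeneous_cost ::
  "(ennreal \<Rightarrow> ennreal) \<Rightarrow> (real^'m \<Rightarrow> real^'d \<Rightarrow> ereal) \<Rightarrow> bool" where
  "super_homogeneous_cost \<delta> c \<longleftrightarrow>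
     (\<forall>s\<ge>0. \<forall>x. \<forall>r\<ge>1. c s (r *\<^sub>R x) \<ge> enn2ereal (\<delta> (ennreal r)) * c s x)"


section \<open>The market\<close>

text \<open>The first coordinate of the portfolio space is the one with index \<open>i1\<close>.  The space of
  vectors \<open>z\<^sup>(\<^sup>2\<^sup>)\<close> is represented by the hyperplane of vectors whose \<open>i1\<close>-coordinate vanishes
  (which also covers the one-dimensional case): \<open>risky i1 z\<close> stands both for \<open>z\<^sup>(\<^sup>2\<^sup>)\<close> and for
  \<open>(0, z\<^sup>(\<^sup>2\<^sup>))\<close>.\<close>

definition risky :: "'d \<Rightarrow> real^'d \<Rightarrow> real^'d" where
  "risky i z = z - (z $ i) *\<^sub>R axis i 1"

text \<open>The process \<open>W\<close> started at time \<open>t\<close>, evaluated one step earlier; \<open>V\<close> is its value at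
  time \<open>t - 1\<close>, which is kept apart because \<open>t\<close> may be \<open>0\<close>.\<close>

definition lag :: "nat \<Rightarrow> ('a \<Rightarrow> 'b) \<Rightarrow> (nat \<Rightarrow> 'a \<Rightarrow> 'b) \<Rightarrow> nat \<Rightarrow> 'a \<Rightarrow> 'b" where
  "lag t V W s = (if s = t then V else W (s - 1))"

text \<open>Only the times up to \<open>T\<close> matter; beyond \<open>T\<close> the filtration may for instance be taken
  to be constant.\<close>

locale cost_market =
  prob_space M + complete_measure M + filtration "space M" F
  for M :: "'a measure" and F :: "nat \<Rightarrow> 'a measure" +
  fixes T :: nat
    and S :: "nat \<Rightarrow> 'a \<Rightarrow> real^'m"
    and C :: "nat \<Rightarrow> real^'m \<Rightarrow> real^'d \<Rightarrow> real"
    and i1 :: 'd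
  assumes sets_F_subset: "sets (F t) \<subseteq> sets M"
    and null_sets_F0: "null_sets M \<subseteq> sets (F 0)"
    and dims: "CARD('d) \<le> CARD('m)"
    and S_adapted: "t \<le> T \<Longrightarrow> S t \<in> borel_measurable (F t)"
    and S_nonneg: "t \<le> T \<Longrightarrow> \<omega> \<in> space M \<Longrightarrow> 0 \<le> S t \<omega>"
    and C_borel: "t \<le> T \<Longrightarrow> (\<lambda>(s, x). C t s x) \<in> borel_measurable borel"
    and C_lsc: "t \<le> T \<Longrightarrow> lsc (\<lambda>(s, x). ereal (C t s x))"
    and C_zero: "t \<le> T \<Longrightarrow> 0 \<le> s \<Longrightarrow> C t s 0 = 0"
    and C_cash: "t \<le> T \<Longrightarrow> 0 \<le> s \<Longrightarrow> C t s (x + r *\<^sub>R axis i1 1) = C t s x + r"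
    and C_mono: "0 \<le> s \<Longrightarrow> x1 \<le> x2 \<Longrightarrow> C T s x1 \<le> C T s x2"
    and C_bound: "t \<le> T \<Longrightarrow>
      \<exists>h. continuous_on UNIV h \<and> (\<forall>s\<ge>0. \<forall>x. \<bar>C t s x\<bar> \<le> h (s, x))"
    and solvency_mono: "t \<le> T \<Longrightarrow>
      AE \<omega> in M. \<forall>z p. - C t (S t \<omega>) (- z) \<ge> 0 \<and> 0 \<le> p \<longrightarrow> - C t (S t \<omega>) (- (z + p)) \<ge> 0"
begin

definition solvency :: "nat \<Rightarrow> 'a \<Rightarrow> (real^'d) set" where
  "solvency t \<omega> = {z. - C t (S t \<omega>) (- z) \<ge> 0}"

text \<open>Together with \<open>solvency_mono\<close> the next four facts are the standing properties of the
  solvency sets; they follow from those of the cost functions.\<close>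

lemma closed_solvency:
  assumes "t \<le> T"
  shows "closed (solvency t \<omega>)"
proof -
  have "open (- solvency t \<omega>)"
    unfolding open_subopen[of "- solvency t \<omega>"]
  proof
    fix z assume "z \<in> - solvency t \<omega>"
    then have "ereal 0 < (\<lambda>(s, x). ereal (C t s x)) (S t \<omega>, - z)" by (auto simp: solvency_def)
    then have "\<forall>\<^sub>F y in nhds (S t \<omega>, - z). ereal 0 < (\<lambda>(s, x). ereal (C t s x)) y"
      using C_lsc[OF assms] unfolding lsc_def by blast
    moreover have "filterlim (\<lambda>z. (S t \<omega>, - z)) (nhds (S t \<omega>, - z)) (nhds z)"
      by (intro tendsto_intros filterlim_ident)
    ultimately have "\<forall>\<^sub>F y in nhds z. ereal 0 < ereal (C t (S t \<omega>) (- y))"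
      unfolding filterlim_iff by fastforce
    then show "\<exists>V. open V \<and> z \<in> V \<and> V \<subseteq> - solvency t \<omega>"
      unfolding eventually_nhds solvency_def by fastforce
  qed
  then show ?thesis by (simp add: closed_def)
qed

lemma solvency_graph_measurable:
  assumes "t \<le> T"
  shows "{(\<omega>, z). \<omega> \<in> space (F t) \<and> z \<in> solvency t \<omega>} \<in> sets (F t \<Otimes>\<^sub>M borel)"
proof -
  note [measurable] = S_adapted[OF assms] C_borel[OF assms]
  have "(\<lambda>p. (\<lambda>(s, x). C t s x) (S t (fst p), - snd p)) \<in> borel_measurable (F t \<Otimes>\<^sub>M borel)"
    by measurable
  then have "(\<lambda>p. - C t (S t (fst p)) (- snd p)) \<in> borel_measurable (F t \<Otimes>\<^sub>M borel)"
    by simp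
  then have "{p \<in> space (F t \<Otimes>\<^sub>M borel). 0 \<le> - C t (S t (fst p)) (- snd p)}
      \<in> sets (F t \<Otimes>\<^sub>M borel)"
    by measurable
  moreover have "{p \<in> space (F t \<Otimes>\<^sub>M borel). 0 \<le> - C t (S t (fst p)) (- snd p)}
      = {(\<omega>, z). \<omega> \<in> space (F t) \<and> z \<in> solvency t \<omega>}"
    by (auto simp: solvency_def space_pair_measure)
  ultimately show ?thesis by simp
qed

lemma minus_e1_notin_solvency:
  assumes "t \<le> T" "\<omega> \<in> space M"
  shows "- axis i1 1 \<notin> solvency t \<omega>"
  using C_cash[OF assms(1) S_nonneg[OF assms], of 0 1] C_zero[OF assms(1) S_nonneg[OF assms]]
  by (simp add: solvency_def)

lemma cost_eq_Least:
  assumes "t \<le> T" "\<omega> \<in> space M"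
  shows "C t (S t \<omega>) z = (LEAST r. r *\<^sub>R axis i1 1 - z \<in> solvency t \<omega>)"
proof -
  have "C t (S t \<omega>) (- (r *\<^sub>R axis i1 1 - z)) = C t (S t \<omega>) z - r" for r
    using C_cash[OF assms(1) S_nonneg[OF assms], of z "- r"] by simp
  then show ?thesis by (intro Least_equality[symmetric]) (auto simp: solvency_def)
qed

text \<open>The value at time \<open>-1\<close> is \<open>x e\<^sub>1\<close> with \<open>x\<close> measurable with respect to the
  sigma-algebra at time \<open>-1\<close>, which is \<open>F 0\<close>.\<close>

definition hedgeable :: "('a \<Rightarrow> real^'d) \<Rightarrow> bool" where
  "hedgeable \<xi> \<longleftrightarrow>
     (\<exists>x V. x \<in> borel_measurable (F 0) \<and> (\<forall>t\<le>T. V t \<in> borel_measurable (F t)) \<and>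
        (\<forall>t\<le>T. AE \<omega> in M.
           V t \<omega> - lag 0 (\<lambda>\<omega>. x \<omega> *\<^sub>R axis i1 1) V t \<omega> \<in> uminus ` solvency t \<omega>) \<and>
        (AE \<omega> in M. V T \<omega> = \<xi> \<omega>))"

text \<open>The entry at time \<open>t - 1\<close> is supplied by \<open>lag\<close> in \<open>hedging_cost\<close>.\<close>

definition strategies :: "nat \<Rightarrow> ('a \<Rightarrow> real^'d) \<Rightarrow> (nat \<Rightarrow> 'a \<Rightarrow> real^'d) set" where
  "strategies t \<xi> =
     {W. (\<forall>s\<in>{t..<T}. W s \<in> borel_measurable (F s) \<and> (\<forall>\<omega>\<in>space M. W s \<omega> $ i1 = 0)) \<and>
         W T = (\<lambda>\<omega>. risky i1 (\<xi> \<omega>))}"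

definition hedging_cost :: "('a \<Rightarrow> real^'d) \<Rightarrow> nat \<Rightarrow> ('a \<Rightarrow> real^'d) \<Rightarrow> 'a \<Rightarrow> ereal" where
  "hedging_cost \<xi> t V =
     ess_inf M (F t)
       {ess_sup M (F t)
          {\<lambda>\<omega>. ereal (\<xi> \<omega> $ i1 +
             (\<Sum>s=t..T. C s (S s \<omega>) (W s \<omega> - lag t (\<lambda>\<omega>. risky i1 (V \<omega>)) W s \<omega>)))}
        | W. W \<in> strategies t \<xi>}"


subsection \<open>The enlarged market\<close>

definition C_hat :: "nat \<Rightarrow> real^'m \<Rightarrow> real^'d \<Rightarrow> ereal" where
  "C_hat t s y = Liminf at_top (\<lambda>r::real. ereal (C t s (r *\<^sub>R y) / r))"

text \<open>The recursion is written out here in one piece; \<open>gamma_hat_less\<close> below restores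
  its usual form.  In \<open>ereal\<close> one has \<open>\<infinity> + (-\<infinity>) = \<infinity>\<close>.\<close>

function gamma_hat ::
  "(real^'m \<Rightarrow> real^'d) \<Rightarrow> nat \<Rightarrow> ('a \<Rightarrow> real^'d) \<Rightarrow> 'a \<Rightarrow> ereal" where
  "gamma_hat g t V =
     (if T \<le> t
      then (\<lambda>\<omega>. ereal (g (S T \<omega>) $ i1) + C_hat T (S T \<omega>) (risky i1 (g (S T \<omega>) - V \<omega>)))
      else ess_inf M (F t)
        {\<lambda>\<omega>. C_hat t (S t \<omega>) (risky i1 (W \<omega> - V \<omega>)) + ess_sup M (F t) {gamma_hat g (Suc t) W} \<omega>
         | W. W \<in> borel_measurable (F t)})"
  by auto
termination by (relation "Wellfounded.measure (\<lambda>(g, t, V). T - t)") auto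

declare gamma_hat.simps [simp del]

definition theta_hat ::
  "(real^'m \<Rightarrow> real^'d) \<Rightarrow> nat \<Rightarrow> ('a \<Rightarrow> real^'d) \<Rightarrow> 'a \<Rightarrow> ereal" where
  "theta_hat g t V = ess_sup M (F t) {gamma_hat g (Suc t) V}"

text \<open>\<open>D_hat t \<theta> s v z\<close> takes the value \<open>\<theta>\<close> of \<open>theta_hat\<close> at the new position \<open>z\<close> as an
  argument, so that it can be evaluated both at random positions and, for a normal integrand
  representing \<open>theta_hat\<close>, at deterministic ones.\<close>

definition D_hat :: "nat \<Rightarrow> ereal \<Rightarrow> real^'m \<Rightarrow> real^'d \<Rightarrow> real^'d \<Rightarrow> ereal" where
  "D_hat t \<theta> s v z = C_hat t s (risky i1 (z - v)) + \<theta>"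

lemma gamma_hat_T:
  "gamma_hat g T V =
     (\<lambda>\<omega>. ereal (g (S T \<omega>) $ i1) + C_hat T (S T \<omega>) (risky i1 (g (S T \<omega>) - V \<omega>)))"
  by (subst gamma_hat.simps) simp

lemma gamma_hat_less:
  "t < T \<Longrightarrow> gamma_hat g t V =
     ess_inf M (F t)
       {\<lambda>\<omega>. D_hat t (theta_hat g t W \<omega>) (S t \<omega>) (V \<omega>) (W \<omega>) | W. W \<in> borel_measurable (F t)}"
  by (subst gamma_hat.simps) (simp add: D_hat_def theta_hat_def)

text \<open>A normal integrand with which \<open>theta_hat\<close> is identified.\<close>

definition represents_theta_hat ::
  "(real^'m \<Rightarrow> real^'d) \<Rightarrow> nat \<Rightarrow> ('a \<Rightarrow> real^'d \<Rightarrow> ereal) \<Rightarrow> bool" where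
  "represents_theta_hat g t \<Theta> \<longleftrightarrow>
     normal_integrand (F t) \<Theta> \<and>
     (\<forall>V\<in>borel_measurable (F t). AE \<omega> in M. \<Theta> \<omega> (V \<omega>) = theta_hat g t V \<omega>)"

end

end

theory Submission
  imports Defs
begin

text \<open>The hedging cost at time \<open>t\<close> is an essential infimum over positions \<open>Z\<close> of essential
suprema of \<open>J \<omega> (V \<omega>, Z \<omega>)\<close>, where
\<open>J \<omega> (v, z) = C t (S t \<omega>) (z - risky v) + \<gamma>' \<omega> (S (t + 1) \<omega>, z)\<close> is lower semicontinuous in
\<open>(v, z)\<close>; this is the dynamic programming principle \<open>hedging_cost_dynamic_programming\<close>. The task
is to realise the map \<open>V \<mapsto> hedging_cost \<xi> t V\<close>, which is defined on random positions and up to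
null sets, by a function of deterministic positions.

This is possible for every map \<open>\<Phi>\<close> from \<open>L\<^sup>0\<close> to extended random variables that is local (the
value on an event depends only on the argument on that event) and lower semicontinuous along
pointwise limits (\<open>local_lsc_representation\<close>): for a countable base of open sets \<open>B\<close>, the
function \<open>h \<omega> v = sup {m B \<omega> | B \<ni> v}\<close> works, where \<open>m B\<close> is the essential infimum of \<open>\<Phi> U\<close> over
random positions \<open>U\<close> with values in \<open>B\<close>. Only countably many random variables \<open>m B\<close> enter, which
makes \<open>h\<close> jointly measurable.

Locality of the hedging cost is clear. For lower semicontinuity, let \<open>U n \<longlonglongrightarrow> V\<close> and pick nearly
optimal positions \<open>Z n\<close> for \<open>U n\<close>. If the \<open>Z n\<close> are bounded pathwise, a random subsequence
converges, and its limit is admissible for \<open>V\<close> by lower semicontinuity of \<open>J\<close>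
(\<open>marginal_integrand\<close>). Boundedness is the role of the enlarged market
(\<open>hedging_positions_bounded\<close>). Since \<open>C_hat\<close> lies below \<open>C\<close> and the payoff is nonnegative, the
hedging cost dominates \<open>gamma_hat\<close> for the zero payoff, and by sub- or super-additivity of \<open>C t\<close> the bounded
shift \<open>U n\<close> changes \<open>C t\<close> by a bounded amount only. Hence \<open>D_hat\<close> at \<open>Z n\<close> stays bounded above.
On the other hand, super-homogeneity passes from \<open>C_hat\<close> through the recursion to \<open>D_hat\<close>, so
that, where the norm of \<open>Z n\<close> is at least 1, \<open>D_hat\<close> at \<open>Z n\<close> is at least \<open>\<delta>\<close> of this norm times
the infimum of \<open>D_hat\<close> over the unit sphere, which is positive. As \<open>\<delta>\<close> is unbounded, the norms
of the \<open>Z n\<close> stay bounded.\<close>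

section \<open>Locality and countable attainment of conditional essential extrema\<close>

locale prob_subalgebra = prob_space M for M :: "'a measure" +
  fixes G :: "'a measure"
  assumes subalg: "subalgebra M G"
begin

lemma space_G: "space G = space M"
  using subalg by (simp add: subalgebra_def)

lemma borel_G_imp_M: "f \<in> measurable G N \<Longrightarrow> f \<in> measurable M N"
  using subalg by (rule measurable_from_subalg)

lemma ess_sup_measurable [measurable]: "ess_sup M G Xs \<in> borel_measurable G"
  using ess_sup_is_ess_sup[OF prob_space_axioms subalg] by (simp add: is_ess_sup_def)

lemma ess_sup_upper: "X \<in> Xs \<Longrightarrow> AE \<omega> in M. X \<omega> \<le> ess_sup M G Xs \<omega>"
  using ess_sup_is_ess_sup[OF prob_space_axioms subalg] by (simp add: is_ess_sup_def)

text \<open>Off the event \<open>A\<close> the competitor may be set to \<open>\<infinity>\<close>, because \<open>A\<close> is itself in \<open>G\<close>. This is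
what makes conditional essential extrema local.\<close>

lemma ess_sup_least_on:
  assumes [measurable]: "A \<in> sets G" "Y \<in> borel_measurable G"
    and le: "AE \<omega> in M. \<omega> \<in> A \<longrightarrow> X \<omega> \<le> Y \<omega>"
  shows "AE \<omega> in M. \<omega> \<in> A \<longrightarrow> ess_sup M G {X} \<omega> \<le> Y \<omega>"
proof -
  define Y' where "Y' \<omega> = (if \<omega> \<in> A then Y \<omega> else \<infinity>)" for \<omega>
  have "Y' \<in> borel_measurable G" unfolding Y'_def by measurable
  moreover have "AE \<omega> in M. X \<omega> \<le> Y' \<omega>" using le by eventually_elim (simp add: Y'_def)
  ultimately have "AE \<omega> in M. ess_sup M G {X} \<omega> \<le> Y' \<omega>"
    using ess_sup_is_ess_sup[OF prob_space_axioms subalg, of "{X}"] by (simp add: is_ess_sup_def)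
  then show ?thesis by eventually_elim (simp add: Y'_def split: if_splits)
qed

lemma ess_sup_least:
  assumes "Y \<in> borel_measurable G" "AE \<omega> in M. X \<omega> \<le> Y \<omega>"
  shows "AE \<omega> in M. ess_sup M G {X} \<omega> \<le> Y \<omega>"
  using ess_sup_is_ess_sup[OF prob_space_axioms subalg, of "{X}"] assms
  by (simp add: is_ess_sup_def)

lemma ess_sup_mono_on:
  assumes "A \<in> sets G" "AE \<omega> in M. \<omega> \<in> A \<longrightarrow> X \<omega> \<le> X' \<omega>"
  shows "AE \<omega> in M. \<omega> \<in> A \<longrightarrow> ess_sup M G {X} \<omega> \<le> ess_sup M G {X'} \<omega>"
  using assms(1) ess_sup_measurable
proof (rule ess_sup_least_on)
  show "AE \<omega> in M. \<omega> \<in> A \<longrightarrow> X \<omega> \<le> ess_sup M G {X'} \<omega>"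
    using assms(2) ess_sup_upper[of X' "{X'}", simplified] by eventually_elim auto
qed

lemma ess_sup_cong_on:
  assumes "A \<in> sets G" "AE \<omega> in M. \<omega> \<in> A \<longrightarrow> X \<omega> = X' \<omega>"
  shows "AE \<omega> in M. \<omega> \<in> A \<longrightarrow> ess_sup M G {X} \<omega> = ess_sup M G {X'} \<omega>"
proof -
  have 1: "AE \<omega> in M. \<omega> \<in> A \<longrightarrow> X \<omega> \<le> X' \<omega>" "AE \<omega> in M. \<omega> \<in> A \<longrightarrow> X' \<omega> \<le> X \<omega>"
    using assms(2) by (auto elim: eventually_mono)
  show ?thesis
    using ess_sup_mono_on[OF assms(1) 1(1)] ess_sup_mono_on[OF assms(1) 1(2)]
    by eventually_elim auto
qed

lemma ess_inf_measurable [measurable]: "ess_inf M G Xs \<in> borel_measurable G"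
  using ess_inf_is_ess_inf[OF prob_space_axioms subalg] by (simp add: is_ess_inf_def)

lemma ess_inf_lower: "X \<in> Xs \<Longrightarrow> AE \<omega> in M. ess_inf M G Xs \<omega> \<le> X \<omega>"
  using ess_inf_is_ess_inf[OF prob_space_axioms subalg] by (simp add: is_ess_inf_def)

lemma ess_inf_greatest:
  assumes "Y \<in> borel_measurable G" "\<And>X. X \<in> Xs \<Longrightarrow> AE \<omega> in M. Y \<omega> \<le> X \<omega>"
  shows "AE \<omega> in M. Y \<omega> \<le> ess_inf M G Xs \<omega>"
  using ess_inf_is_ess_inf[OF prob_space_axioms subalg, of Xs] assms by (simp add: is_ess_inf_def)

lemma ess_inf_mono_on:
  assumes [measurable]: "A \<in> sets G"
    and le: "\<And>Z. Z \<in> Zs \<Longrightarrow> AE \<omega> in M. \<omega> \<in> A \<longrightarrow> Y Z \<omega> \<le> Y' Z \<omega>"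
  shows "AE \<omega> in M. \<omega> \<in> A \<longrightarrow> ess_inf M G (Y ` Zs) \<omega> \<le> ess_inf M G (Y' ` Zs) \<omega>"
proof -
  define X where "X \<omega> = (if \<omega> \<in> A then ess_inf M G (Y ` Zs) \<omega> else -\<infinity>)" for \<omega>
  have "AE \<omega> in M. X \<omega> \<le> ess_inf M G (Y' ` Zs) \<omega>"
  proof (rule ess_inf_greatest)
    show "X \<in> borel_measurable G" unfolding X_def by measurable
    fix Y0 assume "Y0 \<in> Y' ` Zs"
    then obtain Z where Z: "Z \<in> Zs" "Y0 = Y' Z" by auto
    show "AE \<omega> in M. X \<omega> \<le> Y0 \<omega>"
      using ess_inf_lower[OF imageI[OF Z(1), of Y]] le[OF Z(1)]
      unfolding Z(2) by eventually_elim (auto simp: X_def)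
  qed
  then show ?thesis by eventually_elim (simp add: X_def split: if_splits)
qed

lemma ess_inf_cong_on:
  assumes "A \<in> sets G"
    and eq: "\<And>Z. Z \<in> Zs \<Longrightarrow> AE \<omega> in M. \<omega> \<in> A \<longrightarrow> Y Z \<omega> = Y' Z \<omega>"
  shows "AE \<omega> in M. \<omega> \<in> A \<longrightarrow> ess_inf M G (Y ` Zs) \<omega> = ess_inf M G (Y' ` Zs) \<omega>"
proof -
  have 1: "AE \<omega> in M. \<omega> \<in> A \<longrightarrow> Y Z \<omega> \<le> Y' Z \<omega>" "AE \<omega> in M. \<omega> \<in> A \<longrightarrow> Y' Z \<omega> \<le> Y Z \<omega>"
    if "Z \<in> Zs" for Z
    using eq[OF that] by (auto elim: eventually_mono)
  have "AE \<omega> in M. \<omega> \<in> A \<longrightarrow> ess_inf M G (Y ` Zs) \<omega> \<le> ess_inf M G (Y' ` Zs) \<omega>"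
    using assms(1) 1(1) by (rule ess_inf_mono_on)
  moreover have "AE \<omega> in M. \<omega> \<in> A \<longrightarrow> ess_inf M G (Y' ` Zs) \<omega> \<le> ess_inf M G (Y ` Zs) \<omega>"
    using assms(1) 1(2) by (rule ess_inf_mono_on)
  ultimately show ?thesis by eventually_elim auto
qed

text \<open>Among the infima of sequences in \<open>Xs\<close>, take one whose expected value, after a bounded
strictly increasing transformation, is minimal; it exists because countably many sequences can
be merged into one. Adding a further member of \<open>Xs\<close> cannot lower the expected value, hence that
member already dominates the infimum almost surely.\<close>

lemma ess_inf_attained_countably:
  assumes ne: "Xs \<noteq> {}" and meas: "Xs \<subseteq> borel_measurable G"
  shows "\<exists>x. range x \<subseteq> Xs \<and> (AE \<omega> in M. ess_inf M G Xs \<omega> = (INF n::nat. x n \<omega>))"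
proof -
  define J where "J Y = (\<integral>\<omega>. ereal_arctan (Y \<omega>) \<partial>M)" for Y
  define m where "m y \<omega> = (INF n::nat. y n \<omega>)" for y :: "nat \<Rightarrow> 'a \<Rightarrow> ereal" and \<omega>
  define U where "U = {m y | y. range y \<subseteq> Xs}"
  have mG: "m y \<in> borel_measurable G" if "range y \<subseteq> Xs" for y
  proof -
    have [measurable]: "y n \<in> borel_measurable G" for n using that meas by auto
    show ?thesis unfolding m_def by measurable
  qed
  have int: "integrable M (\<lambda>\<omega>. ereal_arctan (Y \<omega>))" if "Y \<in> borel_measurable G" for Y
  proof (rule integrable_const_bound[where B="pi/2"])
    show "AE \<omega> in M. norm (ereal_arctan (Y \<omega>)) \<le> pi/2"
      using ereal_arctan_bound by (intro AE_I2) (simp only: real_norm_def)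
  qed (use borel_G_imp_M[OF that] in measurable)
  have Umeas: "Y \<in> borel_measurable G" if "Y \<in> U" for Y using that mG by (auto simp: U_def)
  have bdd: "bdd_below (J ` U)"
  proof (rule bdd_belowI2[where m="-(pi/2)"])
    fix Y assume Y: "Y \<in> U"
    have "(\<integral>\<omega>. -(pi/2) \<partial>M) \<le> J Y" unfolding J_def
    proof (rule integral_mono)
      show "-(pi/2) \<le> ereal_arctan (Y \<omega>)" for \<omega>
        using ereal_arctan_bound[of "Y \<omega>"] by linarith
    qed (auto simp: int Umeas[OF Y])
    then show "-(pi/2) \<le> J Y" by (simp add: prob_space)
  qed
  obtain X0 where X0: "X0 \<in> Xs" using ne by auto
  have Une: "U \<noteq> {}" using X0 by (auto simp: U_def intro!: exI[of _ "\<lambda>_. X0"])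
  have "\<exists>y. range y \<subseteq> Xs \<and> J (m y) < Inf (J ` U) + inverse (real (Suc n))" for n
  proof -
    have "Inf (J ` U) < Inf (J ` U) + inverse (real (Suc n))" by simp
    then show ?thesis using Une bdd by (subst (asm) cInf_less_iff) (auto simp: U_def)
  qed
  then obtain y where y: "\<And>n. range (y n) \<subseteq> Xs"
      "\<And>n. J (m (y n)) < Inf (J ` U) + inverse (real (Suc n))"
    by metis
  \<comment> \<open>merge the minimising sequence of sequences \<open>y\<close> into a single sequence\<close>
  define x where "x k = y (fst (prod_decode k)) (snd (prod_decode k))" for k
  have x: "range x \<subseteq> Xs" using y(1) by (auto simp: x_def)
  have m_le: "m x \<omega> \<le> m (y n) \<omega>" for n \<omega>
    unfolding m_def
  proof (rule INF_greatest)
    fix i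
    have "(INF k. x k \<omega>) \<le> x (prod_encode (n, i)) \<omega>" by (rule INF_lower) simp
    then show "(INF k. x k \<omega>) \<le> y n i \<omega>" by (simp add: x_def)
  qed
  have Jx: "J (m x) \<le> Inf (J ` U)"
  proof (rule LIMSEQ_le_const)
    show "(\<lambda>n. Inf (J ` U) + inverse (real (Suc n))) \<longlonglongrightarrow> Inf (J ` U)"
      using LIMSEQ_inverse_real_of_nat_add by blast
    have "J (m x) \<le> J (m (y n))" for n unfolding J_def
      by (intro integral_mono int mG x y(1)) (auto simp: ereal_arctan_le_iff m_le)
    then show "\<exists>N. \<forall>n\<ge>N. J (m x) \<le> Inf (J ` U) + inverse (real (Suc n))"
      using y(2) by (meson less_imp_le order_trans)
  qed
  have lower: "AE \<omega> in M. m x \<omega> \<le> X \<omega>" if X: "X \<in> Xs" for X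
  proof -
    define x' where "x' n = (case n of 0 \<Rightarrow> X | Suc k \<Rightarrow> x k)" for n
    have x': "range x' \<subseteq> Xs" using x X by (auto simp: x'_def image_subset_iff split: nat.splits)
    have le: "m x' \<omega> \<le> m x \<omega>" "m x' \<omega> \<le> X \<omega>" for \<omega>
    proof -
      show "m x' \<omega> \<le> X \<omega>" unfolding m_def by (rule INF_lower2[of 0]) (auto simp: x'_def)
      show "m x' \<omega> \<le> m x \<omega>" unfolding m_def
      proof (rule INF_greatest)
        fix i show "(INF n. x' n \<omega>) \<le> x i \<omega>" by (rule INF_lower2[of "Suc i"]) (auto simp: x'_def)
      qed
    qed
    have "m x' \<in> U" using x' by (auto simp: U_def)
    then have "J (m x) \<le> J (m x')" using Jx bdd by (meson cINF_lower order_trans)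
    then have "(\<integral>\<omega>. ereal_arctan (m x \<omega>) - ereal_arctan (m x' \<omega>) \<partial>M) \<le> 0"
      unfolding J_def by (subst Bochner_Integration.integral_diff) (auto simp: int mG x x')
    moreover have nn: "AE \<omega> in M. 0 \<le> ereal_arctan (m x \<omega>) - ereal_arctan (m x' \<omega>)"
      by (auto simp: ereal_arctan_le_iff le)
    ultimately have "(\<integral>\<omega>. ereal_arctan (m x \<omega>) - ereal_arctan (m x' \<omega>) \<partial>M) = 0"
      using integral_nonneg_AE[OF nn] by linarith
    then have "AE \<omega> in M. ereal_arctan (m x \<omega>) - ereal_arctan (m x' \<omega>) = 0"
      using nn int mG x x' by (subst (asm) integral_nonneg_eq_0_iff_AE) auto
    then show ?thesis
    proof eventually_elim
      case (elim \<omega>)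
      then have "m x \<omega> \<le> m x' \<omega>" by (simp add: ereal_arctan_le_iff[symmetric])
      then show ?case using le(2)[of \<omega>] by simp
    qed
  qed
  have "AE \<omega> in M. m x \<omega> \<le> ess_inf M G Xs \<omega>" using mG[OF x] lower by (rule ess_inf_greatest)
  moreover have "AE \<omega> in M. \<forall>n. ess_inf M G Xs \<omega> \<le> x n \<omega>"
    using x by (subst AE_all_countable) (auto intro!: ess_inf_lower)
  ultimately have "AE \<omega> in M. ess_inf M G Xs \<omega> = (INF n. x n \<omega>)"
    by eventually_elim (metis m_def INF_greatest antisym)
  with x show ?thesis by blast
qed

text \<open>Strict inequality below \<open>q\<close> is achieved at each outcome by a member of a countable family
that attains the essential infimum; pasting the members along the random first such index gives
a single member. The decision variables \<open>Z\<close> are kept apart from their values \<open>Y Z\<close> since pasting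
takes place among the former.\<close>

lemma ess_inf_selection:
  fixes Y :: "'z \<Rightarrow> 'a \<Rightarrow> ereal"
  assumes ne: "Zs \<noteq> {}" and meas: "\<And>Z. Z \<in> Zs \<Longrightarrow> Y Z \<in> borel_measurable G"
    and paste: "\<And>z N. (\<And>n::nat. z n \<in> Zs) \<Longrightarrow> N \<in> measurable G (count_space UNIV) \<Longrightarrow>
        \<exists>Z\<in>Zs. AE \<omega> in M. Y Z \<omega> = Y (z (N \<omega>)) \<omega>"
    and less: "AE \<omega> in M. \<omega> \<in> A \<longrightarrow> ess_inf M G (Y ` Zs) \<omega> < q"
  shows "\<exists>Z\<in>Zs. AE \<omega> in M. \<omega> \<in> A \<longrightarrow> Y Z \<omega> < q"
proof -
  obtain x where x: "range x \<subseteq> Y ` Zs" and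
      inf: "AE \<omega> in M. ess_inf M G (Y ` Zs) \<omega> = (INF n::nat. x n \<omega>)"
    using ess_inf_attained_countably[of "Y ` Zs"] ne meas by blast
  then have "\<forall>n. \<exists>Z\<in>Zs. x n = Y Z" by auto
  then obtain z where z: "\<And>n. z n \<in> Zs" "\<And>n. x n = Y (z n)" by metis
  have [measurable]: "Y (z n) \<in> borel_measurable G" for n using z(1) by (rule meas)
  define N where "N \<omega> = (LEAST n. Y (z n) \<omega> < q)" for \<omega>
  have "N \<in> measurable G (count_space UNIV)" unfolding N_def by measurable
  with z(1) have "\<exists>Z\<in>Zs. AE \<omega> in M. Y Z \<omega> = Y (z (N \<omega>)) \<omega>" by (rule paste)
  then obtain Z where Z: "Z \<in> Zs" "AE \<omega> in M. Y Z \<omega> = Y (z (N \<omega>)) \<omega>" by auto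
  have "AE \<omega> in M. \<omega> \<in> A \<longrightarrow> Y Z \<omega> < q"
    using inf less Z(2)
  proof (eventually_elim, intro impI)
    fix \<omega> assume h: "ess_inf M G (Y ` Zs) \<omega> = (INF n. x n \<omega>)" "\<omega> \<in> A \<longrightarrow> ess_inf M G (Y ` Zs) \<omega> < q"
      "Y Z \<omega> = Y (z (N \<omega>)) \<omega>" "\<omega> \<in> A"
    then obtain n where "Y (z n) \<omega> < q" by (auto simp: INF_less_iff z(2))
    then have "Y (z (N \<omega>)) \<omega> < q" unfolding N_def by (rule LeastI)
    with h show "Y Z \<omega> < q" by simp
  qed
  with Z(1) show ?thesis by blast
qed

end

section \<open>Lower semicontinuous functions\<close>

lemma lsc_limit_le:
  assumes f: "lsc f" and lim: "(\<lambda>n. x n) \<longlonglongrightarrow> l" and le: "\<And>n. f (x n) \<le> q"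
  shows "f l \<le> q"
proof (rule ccontr)
  assume "\<not> f l \<le> q"
  then have "\<forall>\<^sub>F y in nhds l. q < f y" using f by (auto simp: lsc_def)
  then have "\<forall>\<^sub>F n in sequentially. q < f (x n)" using lim unfolding filterlim_iff by blast
  then obtain n where "q < f (x n)" by (auto simp: eventually_sequentially)
  with le[of n] show False by simp
qed

text \<open>Finiteness of one summand excludes the sum \<open>\<infinity> + (-\<infinity>) = \<infinity>\<close>, at which lower semicontinuity
would fail.\<close>

lemma lsc_add:
  assumes f: "lsc f" and g: "lsc g" and fin: "\<And>x. \<bar>f x\<bar> \<noteq> \<infinity>"
  shows "lsc (\<lambda>x. f x + g x)"
  unfolding lsc_def
proof (intro allI impI)
  fix x c assume c: "c < f x + g x"
  have "\<exists>a b. a < f x \<and> b < g x \<and> c \<le> a + b"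
  proof (cases "g x")
    case MInf
    then show ?thesis using c fin[of x] by (cases "f x") auto
  next
    case PInf
    obtain r where r: "f x = ereal r" using fin[of x] by (cases "f x") auto
    obtain k where "c < ereal k" using c PInf r ereal_dense2[of c \<infinity>] by auto
    then show ?thesis using PInf r
      by (intro exI[of _ "ereal (r - 1)"] exI[of _ "ereal (k - r + 1)"]) auto
  next
    case (real s)
    obtain r where r: "f x = ereal r" using fin[of x] by (cases "f x") auto
    obtain k where k: "c < ereal k" "ereal k < ereal (r + s)"
      using c real r ereal_dense2[of c "ereal (r + s)"] by auto
    then show ?thesis using real r
      by (intro exI[of _ "ereal (r - (r + s - k) / 2)"] exI[of _ "ereal (s - (r + s - k) / 2)"])
        (auto simp: field_simps)
  qed
  then obtain a b where ab: "a < f x" "b < g x" "c \<le> a + b" by blast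
  have "\<forall>\<^sub>F y in nhds x. a < f y" "\<forall>\<^sub>F y in nhds x. b < g y"
    using f g ab unfolding lsc_def by blast+
  then show "\<forall>\<^sub>F y in nhds x. c < f y + g y"
  proof eventually_elim
    case (elim y)
    then have "a + b < f y + g y" by (rule ereal_add_strict_mono2)
    with ab(3) show ?case by simp
  qed
qed

lemma lsc_compose:
  assumes f: "lsc f" and k: "continuous_on UNIV k"
  shows "lsc (\<lambda>x. f (k x))"
  unfolding lsc_def
proof (intro allI impI)
  fix x c assume "c < f (k x)"
  then have "\<forall>\<^sub>F y in nhds (k x). c < f y" using f by (auto simp: lsc_def)
  moreover have "filterlim k (nhds (k x)) (nhds x)"
    using k by (metis UNIV_I continuous_on_def tendsto_at_iff_tendsto_nhds)
  ultimately show "\<forall>\<^sub>F y in nhds x. c < f (k y)" unfolding filterlim_iff by blast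
qed

section \<open>Normal integrands representing local maps on random variables\<close>

definition selections :: "'a measure \<Rightarrow> 'b::topological_space set \<Rightarrow> ('a \<Rightarrow> 'b) set" where
  "selections G K = {Z \<in> borel_measurable G. \<forall>\<omega>\<in>space G. Z \<omega> \<in> K}"

lemma selections_measurable: "Z \<in> selections G K \<Longrightarrow> Z \<in> borel_measurable G"
  by (simp add: selections_def)

lemma selections_in: "Z \<in> selections G K \<Longrightarrow> \<omega> \<in> space G \<Longrightarrow> Z \<omega> \<in> K"
  by (simp add: selections_def)

lemma const_selection: "x \<in> K \<Longrightarrow> (\<lambda>_. x) \<in> selections G K"
  by (simp add: selections_def)

lemma selections_paste:
  assumes z: "\<And>n::nat. z n \<in> selections G K"
    and [measurable]: "N \<in> measurable G (count_space UNIV)"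
  shows "(\<lambda>\<omega>. z (N \<omega>) \<omega>) \<in> selections G K"
proof -
  have [measurable]: "z n \<in> borel_measurable G" for n using z by (rule selections_measurable)
  have "(\<lambda>\<omega>. z (N \<omega>) \<omega>) \<in> borel_measurable G"
    by (rule measurable_compose_countable) auto
  then show ?thesis using z by (simp add: selections_def)
qed

lemma inverse_Suc_tendsto_0: "(\<lambda>n. 1 / real (Suc n)) \<longlonglongrightarrow> 0"
  using LIMSEQ_inverse_real_of_nat unfolding inverse_eq_divide .

lemma AE_countable_cases:
  assumes "\<And>n::nat. AE \<omega> in M. N \<omega> = n \<longrightarrow> P n \<omega>"
  shows "AE \<omega> in M. P (N \<omega>) \<omega>"
proof -
  have "AE \<omega> in M. \<forall>n. N \<omega> = n \<longrightarrow> P n \<omega>" using assms unfolding AE_all_countable by (rule allI)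
  then show ?thesis by eventually_elim blast
qed

context prob_subalgebra
begin

text \<open>The integrand \<open>h\<close> is the supremum over basic open sets \<open>B\<close> containing the point of the
essential infimum \<open>m B\<close> of \<open>\<Phi>\<close> over \<open>B\<close>-valued arguments. That \<open>h\<close> at \<open>V\<close> lies below \<open>\<Phi> V\<close> only
uses locality. Conversely, where \<open>h\<close> at \<open>V\<close> is below \<open>q\<close>, every basic \<open>B\<close> around \<open>V\<close> contains
the values of some \<open>U\<close> with \<open>\<Phi> U\<close> below \<open>q\<close>; choosing \<open>B\<close> of ever smaller diameter yields
arguments converging to \<open>V\<close>, and lower semicontinuity of \<open>\<Phi>\<close> gives \<open>\<Phi> V \<le> q\<close>.\<close>

lemma local_lsc_representation:
  fixes \<Phi> :: "('a \<Rightarrow> 'b::{metric_space, second_countable_topology}) \<Rightarrow> 'a \<Rightarrow> ereal"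
  assumes meas: "\<And>V. V \<in> borel_measurable G \<Longrightarrow> \<Phi> V \<in> borel_measurable G"
    and loc: "\<And>U V A. U \<in> borel_measurable G \<Longrightarrow> V \<in> borel_measurable G \<Longrightarrow> A \<in> sets G \<Longrightarrow>
      (\<And>\<omega>. \<omega> \<in> A \<Longrightarrow> U \<omega> = V \<omega>) \<Longrightarrow> AE \<omega> in M. \<omega> \<in> A \<longrightarrow> \<Phi> U \<omega> = \<Phi> V \<omega>"
    and lsc: "\<And>U V A q. (\<And>n::nat. U n \<in> borel_measurable G) \<Longrightarrow> V \<in> borel_measurable G \<Longrightarrow>
      A \<in> sets G \<Longrightarrow> (\<And>\<omega>. \<omega> \<in> A \<Longrightarrow> (\<lambda>n. U n \<omega>) \<longlonglongrightarrow> V \<omega>) \<Longrightarrow>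
      (\<And>n. AE \<omega> in M. \<omega> \<in> A \<longrightarrow> \<Phi> (U n) \<omega> \<le> ereal q) \<Longrightarrow>
      AE \<omega> in M. \<omega> \<in> A \<longrightarrow> \<Phi> V \<omega> \<le> ereal q"
  shows "\<exists>h. normal_integrand G h \<and>
    (\<forall>V\<in>borel_measurable G. AE \<omega> in M. h \<omega> (V \<omega>) = \<Phi> V \<omega>)"
proof -
  obtain \<B> :: "'b set set" where \<B>: "countable \<B>" "topological_basis \<B>"
    using ex_countable_basis by blast
  have "\<B> \<noteq> {}" using \<B>(2) by (metis empty_iff open_UNIV topological_basisE UNIV_I)
  define b where "b = from_nat_into \<B>"
  have range_b: "range b = \<B>" unfolding b_def using \<open>\<B> \<noteq> {}\<close> \<B>(1) by (rule range_from_nat_into)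
  have b_open: "open (b k)" for k
    using range_b \<B>(2) topological_basis_open by blast
  have [measurable]: "b k \<in> sets borel" for k using b_open by (rule borel_open)
  define m where "m k = ess_inf M G (\<Phi> ` selections G (b k))" for k
  have [measurable]: "m k \<in> borel_measurable G" for k unfolding m_def by measurable
  define h where "h \<omega> v = (SUP k. if v \<in> b k then m k \<omega> else -\<infinity>)" for \<omega> v
  have h_meas [measurable]: "(\<lambda>(\<omega>, v). h \<omega> v) \<in> borel_measurable (G \<Otimes>\<^sub>M borel)"
    unfolding h_def by measurable
  have "lsc (h \<omega>)" for \<omega>
    unfolding lsc_def
  proof (intro allI impI)
    fix v c assume "c < h \<omega> v"
    then obtain k where "c < (if v \<in> b k then m k \<omega> else -\<infinity>)"
      unfolding h_def less_SUP_iff by blast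
    then have k: "v \<in> b k" "c < m k \<omega>" by (auto split: if_splits)
    have "\<forall>\<^sub>F y in nhds v. y \<in> b k" using b_open k(1) by (rule eventually_nhds_in_open)
    then show "\<forall>\<^sub>F y in nhds v. c < h \<omega> y"
    proof eventually_elim
      case (elim y)
      then show ?case unfolding h_def less_SUP_iff using k(2) by (intro bexI[of _ k]) auto
    qed
  qed
  with h_meas have normal: "normal_integrand G h" by (simp add: normal_integrand_def)
  have "AE \<omega> in M. h \<omega> (V \<omega>) = \<Phi> V \<omega>" if V [measurable]: "V \<in> borel_measurable G" for V
  proof -
    have "AE \<omega> in M. V \<omega> \<in> b k \<longrightarrow> m k \<omega> \<le> \<Phi> V \<omega>" for k
    proof (cases "b k = {}")
      case False
      then obtain x0 where x0: "x0 \<in> b k" by auto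
      \<comment> \<open>redirect \<open>V\<close> into \<open>b k\<close> where it leaves that set; on the event \<open>V \<in> b k\<close> both agree\<close>
      define U where "U \<omega> = (if V \<omega> \<in> b k then V \<omega> else x0)" for \<omega>
      have U [measurable]: "U \<in> borel_measurable G" unfolding U_def by measurable
      then have "U \<in> selections G (b k)" using x0 by (simp add: selections_def U_def)
      then have 1: "AE \<omega> in M. m k \<omega> \<le> \<Phi> U \<omega>" unfolding m_def by (intro ess_inf_lower imageI)
      have "{\<omega> \<in> space G. V \<omega> \<in> b k} \<in> sets G" by measurable
      from loc[OF U V this]
      have 2: "AE \<omega> in M. \<omega> \<in> {\<omega> \<in> space G. V \<omega> \<in> b k} \<longrightarrow> \<Phi> U \<omega> = \<Phi> V \<omega>" by (simp add: U_def)
      show ?thesis using 1 2 AE_space by eventually_elim (auto simp: space_G)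
    qed simp
    then have "AE \<omega> in M. \<forall>k. V \<omega> \<in> b k \<longrightarrow> m k \<omega> \<le> \<Phi> V \<omega>" by (simp add: AE_all_countable)
    then have le: "AE \<omega> in M. h \<omega> (V \<omega>) \<le> \<Phi> V \<omega>"
    proof eventually_elim
      case (elim \<omega>)
      then show ?case unfolding h_def by (intro SUP_least) auto
    qed
    have hV [measurable]: "(\<lambda>\<omega>. h \<omega> (V \<omega>)) \<in> borel_measurable G"
      using measurable_compose[OF measurable_Pair[OF measurable_ident_sets[OF refl] V] h_meas] by simp
    have ge: "AE \<omega> in M. h \<omega> (V \<omega>) < ereal q \<longrightarrow> \<Phi> V \<omega> \<le> ereal q" for q
    proof -
      define A where "A = {\<omega> \<in> space G. h \<omega> (V \<omega>) < ereal q}"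
      have [measurable]: "A \<in> sets G" unfolding A_def by measurable
      have "\<exists>U. U \<in> selections G (b k) \<and>
          (AE \<omega> in M. \<omega> \<in> A \<and> V \<omega> \<in> b k \<longrightarrow> \<Phi> U \<omega> < ereal q)" if "b k \<noteq> {}" for k
      proof -
        have "\<exists>U\<in>selections G (b k).
            AE \<omega> in M. \<omega> \<in> {\<omega>. \<omega> \<in> A \<and> V \<omega> \<in> b k} \<longrightarrow> \<Phi> U \<omega> < ereal q"
        proof (rule ess_inf_selection)
          show "selections G (b k) \<noteq> {}" using that const_selection by blast
          show "\<Phi> Z \<in> borel_measurable G" if "Z \<in> selections G (b k)" for Z
            using that by (intro meas selections_measurable)
          show "\<exists>Z\<in>selections G (b k). AE \<omega> in M. \<Phi> Z \<omega> = \<Phi> (z (N \<omega>)) \<omega>"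
            if z: "\<And>n::nat. z n \<in> selections G (b k)"
              and N [measurable]: "N \<in> measurable G (count_space UNIV)"
            for z N
          proof (rule bexI[OF _ selections_paste[OF z N]])
            show "AE \<omega> in M. \<Phi> (\<lambda>\<omega>. z (N \<omega>) \<omega>) \<omega> = \<Phi> (z (N \<omega>)) \<omega>"
            proof (rule AE_countable_cases)
              fix n
              have "AE \<omega> in M. \<omega> \<in> {\<omega> \<in> space G. N \<omega> = n} \<longrightarrow>
                  \<Phi> (\<lambda>\<omega>. z (N \<omega>) \<omega>) \<omega> = \<Phi> (z n) \<omega>"
                by (intro loc selections_measurable[OF selections_paste[OF z N]]
                    selections_measurable[OF z]) auto
              then show "AE \<omega> in M. N \<omega> = n \<longrightarrow> \<Phi> (\<lambda>\<omega>. z (N \<omega>) \<omega>) \<omega> = \<Phi> (z n) \<omega>"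
                using AE_space by eventually_elim (auto simp: space_G)
            qed
          qed
          show "AE \<omega> in M. \<omega> \<in> {\<omega>. \<omega> \<in> A \<and> V \<omega> \<in> b k} \<longrightarrow>
              ess_inf M G (\<Phi> ` selections G (b k)) \<omega> < ereal q"
          proof (intro AE_I2 impI)
            fix \<omega> assume "\<omega> \<in> {\<omega>. \<omega> \<in> A \<and> V \<omega> \<in> b k}"
            then have "h \<omega> (V \<omega>) < ereal q" "V \<omega> \<in> b k" by (auto simp: A_def)
            moreover have "(if V \<omega> \<in> b k then m k \<omega> else -\<infinity>) \<le> h \<omega> (V \<omega>)"
              unfolding h_def by (rule SUP_upper) simp
            ultimately show "ess_inf M G (\<Phi> ` selections G (b k)) \<omega> < ereal q" by (simp add: m_def)
          qed
        qed
        then show ?thesis by auto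
      qed
      then have "\<forall>k. \<exists>U. b k \<noteq> {} \<longrightarrow> U \<in> selections G (b k) \<and>
          (AE \<omega> in M. \<omega> \<in> A \<and> V \<omega> \<in> b k \<longrightarrow> \<Phi> U \<omega> < ereal q)" by blast
      from choice[OF this] obtain U where U: "\<And>k. b k \<noteq> {} \<Longrightarrow> U k \<in> selections G (b k)"
        "\<And>k. b k \<noteq> {} \<Longrightarrow> AE \<omega> in M. \<omega> \<in> A \<and> V \<omega> \<in> b k \<longrightarrow> \<Phi> (U k) \<omega> < ereal q"
        by blast
      define small where "small n k \<longleftrightarrow> (\<forall>x\<in>b k. \<forall>y\<in>b k. dist x y < 1 / real (Suc n))" for n k
      define U' where "U' k = (if b k = {} then V else U k)" for k
      have U' [measurable]: "U' k \<in> borel_measurable G" for k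
        using U(1) by (auto simp: U'_def selections_def)
      \<comment> \<open>pasting the \<open>U\<close> along a random basic set stays within \<open>1 / (n + 1)\<close> of \<open>V\<close>\<close>
      define N where "N n \<omega> = (LEAST k. small n k \<and> V \<omega> \<in> b k)" for n \<omega>
      have N: "small n (N n \<omega>)" "V \<omega> \<in> b (N n \<omega>)" for n \<omega>
      proof -
        define B where "B = ball (V \<omega>) (1 / real (Suc n) / 2)"
        have "V \<omega> \<in> B" "open B" by (auto simp: B_def)
        then obtain k where k: "V \<omega> \<in> b k" "b k \<subseteq> B"
          using topological_basisE[OF \<B>(2)] range_b by (metis rangeE)
        have "dist x y < 1 / real (Suc n)" if "x \<in> b k" "y \<in> b k" for x y
        proof -
          have "dist (V \<omega>) x < 1 / real (Suc n) / 2" "dist (V \<omega>) y < 1 / real (Suc n) / 2"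
            using that k(2) unfolding B_def by auto
          then show ?thesis by (rule dist_triangle_half_r)
        qed
        then have "small n k \<and> V \<omega> \<in> b k" using k by (auto simp: small_def)
        then have "small n (N n \<omega>) \<and> V \<omega> \<in> b (N n \<omega>)" unfolding N_def by (rule LeastI)
        then show "small n (N n \<omega>)" "V \<omega> \<in> b (N n \<omega>)" by auto
      qed
      have N_meas [measurable]: "N n \<in> measurable G (count_space UNIV)" for n
        unfolding N_def by measurable
      define W where "W n \<omega> = U' (N n \<omega>) \<omega>" for n \<omega>
      have W [measurable]: "W n \<in> borel_measurable G" for n
        unfolding W_def by (rule measurable_compose_countable) auto
      have W_lim: "(\<lambda>n. W n \<omega>) \<longlonglongrightarrow> V \<omega>" if "\<omega> \<in> A" for \<omega>
      proof (rule metric_tendsto_imp_tendsto)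
        show "(\<lambda>n. 1 / real (Suc n)) \<longlonglongrightarrow> 0" by (rule inverse_Suc_tendsto_0)
        have "dist (W n \<omega>) (V \<omega>) < 1 / real (Suc n)" for n
        proof -
          have ne: "b (N n \<omega>) \<noteq> {}" using N(2)[of \<omega> n] by auto
          then have "W n \<omega> \<in> b (N n \<omega>)"
            using selections_in[OF U(1)[OF ne], of \<omega>] that by (simp add: W_def U'_def A_def)
          with N(1)[of n \<omega>] N(2)[of \<omega> n] show ?thesis by (simp add: small_def)
        qed
        then show "\<forall>\<^sub>F n in sequentially. dist (W n \<omega>) (V \<omega>) \<le> dist (1 / real (Suc n)) 0"
          by (intro always_eventually allI) (simp add: less_imp_le)
      qed
      have W_le: "AE \<omega> in M. \<omega> \<in> A \<longrightarrow> \<Phi> (W n) \<omega> \<le> ereal q" for n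
      proof -
        have "AE \<omega> in M. N n \<omega> = k \<longrightarrow> \<omega> \<in> A \<longrightarrow> \<Phi> (W n) \<omega> \<le> ereal q" for k
        proof (cases "b k = {}")
          case True
          then have "N n \<omega> \<noteq> k" for \<omega> using N(2)[of \<omega> n] by auto
          then show ?thesis by simp
        next
          case False
          have "AE \<omega> in M. \<omega> \<in> {\<omega> \<in> space G. N n \<omega> = k} \<longrightarrow> \<Phi> (W n) \<omega> = \<Phi> (U' k) \<omega>"
            by (intro loc W U') (auto simp: W_def)
          with U(2)[OF False] AE_space show ?thesis
          proof eventually_elim
            case (elim \<omega>)
            then show ?case using N(2)[of \<omega> n] False
              by (auto simp: space_G U'_def less_imp_le)
          qed
        qed
        then show ?thesis by (rule AE_countable_cases)
      qed
      have "AE \<omega> in M. \<omega> \<in> A \<longrightarrow> \<Phi> V \<omega> \<le> ereal q"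
        using W V \<open>A \<in> sets G\<close> W_lim W_le by (rule lsc)
      then show ?thesis using AE_space by eventually_elim (auto simp: A_def space_G)
    qed
    have "AE \<omega> in M. \<forall>q::rat. h \<omega> (V \<omega>) < ereal (of_rat q) \<longrightarrow> \<Phi> V \<omega> \<le> ereal (of_rat q)"
      using ge by (simp add: AE_all_countable)
    with le show ?thesis
    proof eventually_elim
      case (elim \<omega>)
      have "\<Phi> V \<omega> \<le> h \<omega> (V \<omega>)"
      proof (rule ccontr)
        assume "\<not> ?thesis"
        then have "h \<omega> (V \<omega>) < \<Phi> V \<omega>" by simp
        from ereal_dense3[OF this] obtain q
          where "h \<omega> (V \<omega>) < ereal (of_rat q)" "ereal (of_rat q) < \<Phi> V \<omega>" by blast
        with elim show False by (auto simp: not_le[symmetric])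
      qed
      with elim show ?case by simp
    qed
  qed
  with normal show ?thesis by blast
qed

end

section \<open>Random convergent subsequences\<close>

text \<open>A measurable form of the Bolzano-Weierstrass theorem, one coordinate at a time: the limit
superior of the coordinate along the indices found so far is a measurable cluster value, and the
first index at or beyond \<open>k\<close> that comes within \<open>1 / (k + 1)\<close> of it is measurable too. The
indices \<open>N k\<close> need not increase; \<open>k \<le> N k\<close> suffices to preserve limits.\<close>

lemma random_convergent_coordinates:
  fixes Z :: "nat \<Rightarrow> 'a \<Rightarrow> 'b::euclidean_space"
  assumes [measurable]: "\<And>n. Z n \<in> borel_measurable G"
    and "finite I" "I \<subseteq> Basis"
  shows "\<exists>N. (\<forall>k. N k \<in> measurable G (count_space UNIV)) \<and>
    (\<forall>\<omega>. bounded (range (\<lambda>n. Z n \<omega>)) \<longrightarrow>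
      (\<forall>k. k \<le> N k \<omega>) \<and> (\<forall>i\<in>I. convergent (\<lambda>k. Z (N k \<omega>) \<omega> \<bullet> i)))"
  using assms(2,3)
proof (induction I rule: finite_induct)
  case empty
  show ?case by (intro exI[of _ "\<lambda>k _. k"]) simp
next
  case (insert i I)
  then obtain N where N0: "\<forall>k. N k \<in> measurable G (count_space UNIV)"
      "\<forall>\<omega>. bounded (range (\<lambda>n. Z n \<omega>)) \<longrightarrow>
        (\<forall>k. k \<le> N k \<omega>) \<and> (\<forall>j\<in>I. convergent (\<lambda>k. Z (N k \<omega>) \<omega> \<bullet> j))"
    by auto
  then have N [measurable]: "\<And>k. N k \<in> measurable G (count_space UNIV)"
    and N_ge: "\<And>\<omega> k. bounded (range (\<lambda>n. Z n \<omega>)) \<Longrightarrow> k \<le> N k \<omega>"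
    and N_conv: "\<And>\<omega> j. bounded (range (\<lambda>n. Z n \<omega>)) \<Longrightarrow> j \<in> I \<Longrightarrow>
      convergent (\<lambda>k. Z (N k \<omega>) \<omega> \<bullet> j)"
    by blast+
  define x where "x k \<omega> = Z (N k \<omega>) \<omega> \<bullet> i" for k \<omega>
  have ZN [measurable]: "(\<lambda>\<omega>. Z (N k \<omega>) \<omega>) \<in> borel_measurable G" for k
    by (rule measurable_compose_countable) auto
  have x [measurable]: "x k \<in> borel_measurable G" for k unfolding x_def by measurable
  define L where "L \<omega> = real_of_ereal (limsup (\<lambda>k. ereal (x k \<omega>)))" for \<omega>
  have L [measurable]: "L \<in> borel_measurable G" unfolding L_def by measurable
  define m where "m k \<omega> = (LEAST n. k \<le> n \<and> dist (x n \<omega>) (L \<omega>) < 1 / real (Suc k))" for k \<omega>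
  have m_meas [measurable]: "m k \<in> measurable G (count_space UNIV)" for k
    unfolding m_def by measurable
  have m: "k \<le> m k \<omega>" "dist (x (m k \<omega>) \<omega>) (L \<omega>) < 1 / real (Suc k)"
    if bdd: "bounded (range (\<lambda>n. Z n \<omega>))" for k \<omega>
  proof -
    obtain B where B: "\<And>n. norm (Z n \<omega>) \<le> B" using bdd by (auto simp: bounded_iff)
    have xB: "\<bar>x n \<omega>\<bar> \<le> B" for n
      unfolding x_def
      using order_trans[OF Basis_le_norm[of i "Z (N n \<omega>) \<omega>"] B] insert.prems by simp
    let ?l = "limsup (\<lambda>k. ereal (x k \<omega>))"
    have "?l \<le> ereal B" using xB by (intro Limsup_bounded always_eventually allI) (simp add: abs_le_iff)
    moreover have "ereal (- B) \<le> ?l"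
    proof -
      have "ereal (- B) \<le> liminf (\<lambda>k. ereal (x k \<omega>))"
      proof (intro Liminf_bounded always_eventually allI)
        show "ereal (- B) \<le> ereal (x k \<omega>)" for k using xB[of k] by simp
      qed
      also have "\<dots> \<le> ?l" by (rule Liminf_le_Limsup) simp
      finally show ?thesis .
    qed
    ultimately have l: "?l = ereal (L \<omega>)" unfolding L_def by (cases ?l) auto
    have "\<exists>n\<ge>k. dist (x n \<omega>) (L \<omega>) < 1 / real (Suc k)"
    proof -
      let ?e = "1 / real (Suc k)"
      have "\<forall>\<^sub>F n in sequentially. ereal (x n \<omega>) < ereal (L \<omega> + ?e)"
        by (rule Limsup_lessD) (simp add: l)
      then obtain K where K: "\<And>n. n \<ge> K \<Longrightarrow> x n \<omega> < L \<omega> + ?e"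
        by (auto simp: eventually_sequentially)
      have "\<exists>n\<ge>max k K. L \<omega> - ?e < x n \<omega>"
      proof (rule ccontr)
        assume "\<not> ?thesis"
        then have "\<forall>\<^sub>F n in sequentially. ereal (x n \<omega>) \<le> ereal (L \<omega> - ?e)"
          unfolding eventually_sequentially by (intro exI[of _ "max k K"]) (auto simp: not_less)
        then have "?l \<le> ereal (L \<omega> - ?e)" by (rule Limsup_bounded)
        then show False unfolding l by (simp add: field_simps)
      qed
      then obtain n where "n \<ge> max k K" "L \<omega> - ?e < x n \<omega>" by auto
      with K[of n] show ?thesis by (intro exI[of _ n]) (auto simp: dist_real_def abs_less_iff)
    qed
    then have "k \<le> m k \<omega> \<and> dist (x (m k \<omega>) \<omega>) (L \<omega>) < 1 / real (Suc k)"
      unfolding m_def by (rule LeastI_ex)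
    then show "k \<le> m k \<omega>" "dist (x (m k \<omega>) \<omega>) (L \<omega>) < 1 / real (Suc k)" by auto
  qed
  show ?case
  proof (intro exI[of _ "\<lambda>k \<omega>. N (m k \<omega>) \<omega>"] conjI allI impI ballI)
    show "(\<lambda>\<omega>. N (m k \<omega>) \<omega>) \<in> measurable G (count_space UNIV)" for k
      by (rule measurable_compose_countable) auto
    fix \<omega> assume bdd: "bounded (range (\<lambda>n. Z n \<omega>))"
    show "k \<le> N (m k \<omega>) \<omega>" for k
      using m(1)[OF bdd, of k] N_ge[OF bdd, of "m k \<omega>"] by linarith
    have m_top: "filterlim (\<lambda>k. m k \<omega>) at_top sequentially"
      by (rule filterlim_at_top_mono[OF filterlim_ident]) (simp add: m(1)[OF bdd])
    fix j assume "j \<in> insert i I"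
    then show "convergent (\<lambda>k. Z (N (m k \<omega>) \<omega>) \<omega> \<bullet> j)"
    proof
      assume j: "j = i"
      have "(\<lambda>k. x (m k \<omega>) \<omega>) \<longlonglongrightarrow> L \<omega>"
      proof (rule metric_tendsto_imp_tendsto)
        show "(\<lambda>n. 1 / real (Suc n)) \<longlonglongrightarrow> 0" by (rule inverse_Suc_tendsto_0)
        show "\<forall>\<^sub>F k in sequentially. dist (x (m k \<omega>) \<omega>) (L \<omega>) \<le> dist (1 / real (Suc k)) 0"
          using m(2)[OF bdd] by (intro always_eventually allI) (simp add: less_imp_le)
      qed
      then show ?thesis unfolding j x_def by (rule convergentI)
    next
      assume "j \<in> I"
      then obtain l where "(\<lambda>k. Z (N k \<omega>) \<omega> \<bullet> j) \<longlonglongrightarrow> l"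
        using N_conv[OF bdd] by (auto simp: convergent_def)
      then have "(\<lambda>k. Z (N (m k \<omega>) \<omega>) \<omega> \<bullet> j) \<longlonglongrightarrow> l"
        using m_top by (rule filterlim_compose)
      then show ?thesis by (rule convergentI)
    qed
  qed
qed

lemma random_convergent_subsequence:
  fixes Z :: "nat \<Rightarrow> 'a \<Rightarrow> 'b::euclidean_space"
  assumes "\<And>n. Z n \<in> borel_measurable G"
  shows "\<exists>N. (\<forall>k. N k \<in> measurable G (count_space UNIV)) \<and>
    (\<forall>\<omega>. bounded (range (\<lambda>n. Z n \<omega>)) \<longrightarrow>
      (\<forall>k. k \<le> N k \<omega>) \<and> convergent (\<lambda>k. Z (N k \<omega>) \<omega>))"
proof -
  have "convergent z" if "\<forall>i\<in>Basis. convergent (\<lambda>k. z k \<bullet> i)" for z :: "nat \<Rightarrow> 'b"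
  proof -
    from that obtain l where l: "\<And>i. i \<in> Basis \<Longrightarrow> (\<lambda>k. z k \<bullet> i) \<longlonglongrightarrow> l i"
      unfolding convergent_def by metis
    have "(\<lambda>k. \<Sum>i\<in>Basis. (z k \<bullet> i) *\<^sub>R i) \<longlonglongrightarrow> (\<Sum>i\<in>Basis. l i *\<^sub>R i)"
      by (intro tendsto_intros l)
    then show ?thesis by (auto simp: euclidean_representation convergent_def)
  qed
  then show ?thesis
    using random_convergent_coordinates[OF assms finite_Basis order_refl] by meson
qed

section \<open>Marginals of coercive integrands\<close>

context prob_subalgebra
begin

text \<open>The map to be represented is local because essential extrema are. Lower semicontinuity is
the classical argument for inf-projections of coercive integrands: nearly optimal \<open>Z n\<close> for
\<open>U n\<close> are bounded, converge along a random subsequence, and the limit is as good for \<open>V\<close>.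
Coercivity is imposed on sequences of random positions rather than at fixed \<open>\<omega>\<close>, because lower
bounds for \<open>J\<close> that hold only almost surely for each random position suffice to verify it.\<close>

lemma marginal_integrand:
  fixes J :: "'a \<Rightarrow> ('b::{metric_space, second_countable_topology}) \<times> ('c::euclidean_space) \<Rightarrow> ereal"
  assumes K: "closed K" "K \<noteq> {}"
    and lsc: "\<And>\<omega>. \<omega> \<in> space M \<Longrightarrow> lsc (J \<omega>)"
    and coercive: "\<And>U V Z A q. (\<And>n::nat. U n \<in> borel_measurable G) \<Longrightarrow> V \<in> borel_measurable G \<Longrightarrow>
      (\<And>n. Z n \<in> selections G K) \<Longrightarrow> A \<in> sets G \<Longrightarrow>
      (\<And>\<omega>. \<omega> \<in> A \<Longrightarrow> (\<lambda>n. U n \<omega>) \<longlonglongrightarrow> V \<omega>) \<Longrightarrow>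
      (\<And>n. AE \<omega> in M. \<omega> \<in> A \<longrightarrow> J \<omega> (U n \<omega>, Z n \<omega>) \<le> ereal q) \<Longrightarrow>
      AE \<omega> in M. \<omega> \<in> A \<longrightarrow> bounded (range (\<lambda>n. Z n \<omega>))"
  shows "\<exists>h. normal_integrand G h \<and> (\<forall>V\<in>borel_measurable G. AE \<omega> in M.
    h \<omega> (V \<omega>) = ess_inf M G ((\<lambda>Z. ess_sup M G {\<lambda>\<omega>. J \<omega> (V \<omega>, Z \<omega>)}) ` selections G K) \<omega>)"
proof (rule local_lsc_representation)
  let ?Y = "\<lambda>V Z. ess_sup M G {\<lambda>\<omega>. J \<omega> (V \<omega>, Z \<omega>)}"
  let ?\<Phi> = "\<lambda>V. ess_inf M G (?Y V ` selections G K)"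
  show "?\<Phi> V \<in> borel_measurable G" for V by measurable
  show "AE \<omega> in M. \<omega> \<in> A \<longrightarrow> ?\<Phi> U \<omega> = ?\<Phi> V \<omega>"
    if "A \<in> sets G" "\<And>\<omega>. \<omega> \<in> A \<Longrightarrow> U \<omega> = V \<omega>" for U V A
    using that(1)
  proof (rule ess_inf_cong_on)
    fix Z
    show "AE \<omega> in M. \<omega> \<in> A \<longrightarrow> ?Y U Z \<omega> = ?Y V Z \<omega>"
      using that by (intro ess_sup_cong_on) auto
  qed
  fix U :: "nat \<Rightarrow> 'a \<Rightarrow> 'b" and V A q
  assume U: "\<And>n. U n \<in> borel_measurable G" and V: "V \<in> borel_measurable G"
    and A [measurable]: "A \<in> sets G" and lim: "\<And>\<omega>. \<omega> \<in> A \<Longrightarrow> (\<lambda>n. U n \<omega>) \<longlonglongrightarrow> V \<omega>"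
    and le: "\<And>n. AE \<omega> in M. \<omega> \<in> A \<longrightarrow> ?\<Phi> (U n) \<omega> \<le> ereal q"
  have "AE \<omega> in M. \<omega> \<in> A \<longrightarrow> ?\<Phi> V \<omega> \<le> ereal r" if "q < r" for r
  proof -
    have "\<exists>Z\<in>selections G K. AE \<omega> in M. \<omega> \<in> A \<longrightarrow> ?Y (U n) Z \<omega> < ereal r" for n
    proof (rule ess_inf_selection)
      show "selections G K \<noteq> {}" using K(2) const_selection by blast
      show "?Y (U n) Z \<in> borel_measurable G" for Z by measurable
      show "\<exists>Z\<in>selections G K. AE \<omega> in M. ?Y (U n) Z \<omega> = ?Y (U n) (z (N \<omega>)) \<omega>"
        if z: "\<And>k::nat. z k \<in> selections G K" and N [measurable]: "N \<in> measurable G (count_space UNIV)"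
        for z N
      proof (rule bexI[OF _ selections_paste[OF z N]])
        show "AE \<omega> in M. ?Y (U n) (\<lambda>\<omega>. z (N \<omega>) \<omega>) \<omega> = ?Y (U n) (z (N \<omega>)) \<omega>"
        proof (rule AE_countable_cases)
          fix k
          have "AE \<omega> in M. \<omega> \<in> {\<omega> \<in> space G. N \<omega> = k} \<longrightarrow>
              ?Y (U n) (\<lambda>\<omega>. z (N \<omega>) \<omega>) \<omega> = ?Y (U n) (z k) \<omega>"
            by (intro ess_sup_cong_on) auto
          then show "AE \<omega> in M. N \<omega> = k \<longrightarrow>
              ?Y (U n) (\<lambda>\<omega>. z (N \<omega>) \<omega>) \<omega> = ?Y (U n) (z k) \<omega>"
            using AE_space by eventually_elim (auto simp: space_G)
        qed
      qed
      show "AE \<omega> in M. \<omega> \<in> A \<longrightarrow> ?\<Phi> (U n) \<omega> < ereal r"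
        using le[of n]
      proof eventually_elim
        case (elim \<omega>)
        then show ?case using that by (auto intro: le_less_trans)
      qed
    qed
    then have "\<forall>n. \<exists>Z. Z \<in> selections G K \<and> (AE \<omega> in M. \<omega> \<in> A \<longrightarrow> ?Y (U n) Z \<omega> < ereal r)"
      by blast
    from choice[OF this] obtain Z where Z: "\<And>n. Z n \<in> selections G K"
      and Zr: "\<And>n. AE \<omega> in M. \<omega> \<in> A \<longrightarrow> ?Y (U n) (Z n) \<omega> < ereal r" by blast
    have [measurable]: "Z n \<in> borel_measurable G" for n using Z by (rule selections_measurable)
    have J: "AE \<omega> in M. \<omega> \<in> A \<longrightarrow> J \<omega> (U n \<omega>, Z n \<omega>) \<le> ereal r" for n
      using Zr[of n] ess_sup_upper[of "\<lambda>\<omega>. J \<omega> (U n \<omega>, Z n \<omega>)" "{\<lambda>\<omega>. J \<omega> (U n \<omega>, Z n \<omega>)}", simplified]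
      by eventually_elim (auto intro: order_trans less_imp_le)
    from U V Z A lim J have bdd: "AE \<omega> in M. \<omega> \<in> A \<longrightarrow> bounded (range (\<lambda>n. Z n \<omega>))"
      by (rule coercive)
    obtain N where N [measurable]: "\<And>k. N k \<in> measurable G (count_space UNIV)"
      and N_ge: "\<And>\<omega> k. bounded (range (\<lambda>n. Z n \<omega>)) \<Longrightarrow> k \<le> N k \<omega>"
      and N_conv: "\<And>\<omega>. bounded (range (\<lambda>n. Z n \<omega>)) \<Longrightarrow> convergent (\<lambda>k. Z (N k \<omega>) \<omega>)"
      using random_convergent_subsequence[of Z G] by auto
    obtain z0 where z0: "z0 \<in> K" using K(2) by auto
    define B where "B = {\<omega> \<in> space G. \<exists>b::nat. \<forall>n. norm (Z n \<omega>) \<le> real b}"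
    have B [measurable]: "B \<in> sets G" unfolding B_def by measurable
    have B_iff: "\<omega> \<in> B \<longleftrightarrow> bounded (range (\<lambda>n. Z n \<omega>))" if "\<omega> \<in> space G" for \<omega>
    proof
      show "bounded (range (\<lambda>n. Z n \<omega>))" if "\<omega> \<in> B" using that by (auto simp: B_def bounded_iff)
      assume "bounded (range (\<lambda>n. Z n \<omega>))"
      then obtain c where c: "\<And>n. norm (Z n \<omega>) \<le> c" by (auto simp: bounded_iff)
      obtain b :: nat where "c \<le> real b" using real_arch_simple by blast
      then show "\<omega> \<in> B" using \<open>\<omega> \<in> space G\<close> c order_trans unfolding B_def by blast
    qed
    \<comment> \<open>a constant position replaces unbounded paths, so that the sequence converges at every outcome\<close>
    define Z' where "Z' k \<omega> = (if \<omega> \<in> B then Z (N k \<omega>) \<omega> else z0)" for k \<omega>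
    have ZN [measurable]: "(\<lambda>\<omega>. Z (N k \<omega>) \<omega>) \<in> borel_measurable G" for k
      by (rule measurable_compose_countable) auto
    have [measurable]: "Z' k \<in> borel_measurable G" for k unfolding Z'_def by measurable
    define L where "L \<omega> = lim (\<lambda>k. Z' k \<omega>)" for \<omega>
    have Z'L: "(\<lambda>k. Z' k \<omega>) \<longlonglongrightarrow> L \<omega>" if "\<omega> \<in> space G" for \<omega>
      unfolding L_def convergent_LIMSEQ_iff[symmetric]
    proof (cases "\<omega> \<in> B")
      case True
      then show "convergent (\<lambda>k. Z' k \<omega>)" using N_conv[of \<omega>] B_iff[OF that] by (simp add: Z'_def)
    next
      case False
      then show "convergent (\<lambda>k. Z' k \<omega>)" by (simp add: Z'_def convergent_const)
    qed
    have L_meas: "L \<in> borel_measurable G"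
      by (rule borel_measurable_LIMSEQ_metric[where f=Z']) (auto intro: Z'L)
    have "L \<omega> \<in> K" if "\<omega> \<in> space G" for \<omega>
    proof (rule closed_sequentially[OF K(1) _ Z'L[OF that]])
      show "Z' k \<omega> \<in> K" for k using selections_in[OF Z that] z0 by (simp add: Z'_def)
    qed
    with L_meas have L_sel: "L \<in> selections G K" by (simp add: selections_def)
    have "AE \<omega> in M. \<forall>n. \<omega> \<in> A \<longrightarrow> J \<omega> (U n \<omega>, Z n \<omega>) \<le> ereal r"
      using J unfolding AE_all_countable by (rule allI)
    then have "AE \<omega> in M. \<omega> \<in> A \<longrightarrow> J \<omega> (V \<omega>, L \<omega>) \<le> ereal r"
      using bdd AE_space
    proof (eventually_elim, intro impI)
      fix \<omega> assume h: "\<forall>n. \<omega> \<in> A \<longrightarrow> J \<omega> (U n \<omega>, Z n \<omega>) \<le> ereal r"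
        "\<omega> \<in> A \<longrightarrow> bounded (range (\<lambda>n. Z n \<omega>))" "\<omega> \<in> space M" "\<omega> \<in> A"
      then have b: "bounded (range (\<lambda>n. Z n \<omega>))" "\<omega> \<in> B" by (auto simp: B_iff space_G)
      have N_top: "filterlim (\<lambda>k. N k \<omega>) at_top sequentially"
        by (rule filterlim_at_top_mono[OF filterlim_ident]) (simp add: N_ge[OF b(1)])
      have "(\<lambda>k. (U (N k \<omega>) \<omega>, Z (N k \<omega>) \<omega>)) \<longlonglongrightarrow> (V \<omega>, L \<omega>)"
        using filterlim_compose[OF lim[OF h(4)] N_top] Z'L[of \<omega>] b(2) h(3)
        by (intro tendsto_Pair) (simp_all add: Z'_def space_G)
      with lsc[OF h(3)] show "J \<omega> (V \<omega>, L \<omega>) \<le> ereal r"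
        by (rule lsc_limit_le) (use h in auto)
    qed
    then have "AE \<omega> in M. \<omega> \<in> A \<longrightarrow> ?Y V L \<omega> \<le> ereal r"
      using A by (intro ess_sup_least_on) auto
    moreover have "AE \<omega> in M. ?\<Phi> V \<omega> \<le> ?Y V L \<omega>" using L_sel by (intro ess_inf_lower imageI)
    ultimately show ?thesis by eventually_elim auto
  qed
  then have "AE \<omega> in M. \<forall>n. \<omega> \<in> A \<longrightarrow> ?\<Phi> V \<omega> \<le> ereal (q + 1 / real (Suc n))"
    by (subst AE_all_countable) simp
  then show "AE \<omega> in M. \<omega> \<in> A \<longrightarrow> ?\<Phi> V \<omega> \<le> ereal q"
  proof (eventually_elim, intro impI)
    fix \<omega> assume h: "\<forall>n. \<omega> \<in> A \<longrightarrow> ?\<Phi> V \<omega> \<le> ereal (q + 1 / real (Suc n))" "\<omega> \<in> A"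
    have "(\<lambda>n. ereal (q + 1 / real (Suc n))) \<longlonglongrightarrow> ereal (q + 0)"
      by (intro tendsto_intros inverse_Suc_tendsto_0)
    then show "?\<Phi> V \<omega> \<le> ereal q"
      using h by (intro LIMSEQ_le_const[where X="\<lambda>n. ereal (q + 1 / real (Suc n))"]) auto
  qed
qed

end

section \<open>Dynamic programming for the hedging cost\<close>

lemma risky_nth: "risky i z $ j = (if j = i then 0 else z $ j)"
  by (simp add: risky_def axis_def)

lemma risky_eq: "z $ i = 0 \<Longrightarrow> risky i z = z"
  by (simp add: risky_def)

lemma risky_scaleR: "risky i (r *\<^sub>R z) = r *\<^sub>R risky i z"
  by (simp add: vec_eq_iff risky_nth)

lemma continuous_on_risky [continuous_intros]:
  "continuous_on X f \<Longrightarrow> continuous_on X (\<lambda>x. risky i (f x))"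
  unfolding risky_def by (intro continuous_intros)

lemma risky_measurable [measurable]:
  "f \<in> borel_measurable G \<Longrightarrow> (\<lambda>x. risky i (f x)) \<in> borel_measurable G"
  by (rule borel_measurable_continuous_on[of "risky i"]) (intro continuous_intros)

lemma ereal_add_le_iff: "ereal c + x \<le> y \<longleftrightarrow> x \<le> y - ereal c"
  by (cases x; cases y) auto

lemma ereal_mult_add_distrib: "0 < d \<Longrightarrow> ereal d * (a + b) = ereal d * a + ereal d * b"
  by (cases a; cases b) (auto simp: algebra_simps)

lemma ereal_mult_le_iff: "0 < d \<Longrightarrow> ereal d * x \<le> y \<longleftrightarrow> x \<le> ereal (inverse d) * y"
  by (cases x; cases y) (auto simp: field_simps)

context cost_market
begin

abbreviation risky_space :: "(real^'d) set" where
  "risky_space \<equiv> {z. z $ i1 = 0}"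

lemma prob_subalgebra_F: "prob_subalgebra M (F t)"
  by unfold_locales (auto simp: subalgebra_def sets_F_subset space_F)

lemma F_mono_measurable: "f \<in> measurable (F s) N \<Longrightarrow> s \<le> t \<Longrightarrow> f \<in> measurable (F t) N"
  by (rule measurable_from_subalg[of _ "F s"]) (auto simp: subalgebra_def space_F sets_F_mono)

lemma cost_measurable:
  assumes "t \<le> T" and X [measurable]: "X \<in> borel_measurable (F t)"
  shows "(\<lambda>\<omega>. C t (S t \<omega>) (X \<omega>)) \<in> borel_measurable (F t)"
proof -
  note [measurable] = S_adapted[OF assms(1)] C_borel[OF assms(1)]
  have "(\<lambda>\<omega>. (\<lambda>(s, x). C t s x) (S t \<omega>, X \<omega>)) \<in> borel_measurable (F t)" by measurable
  then show ?thesis by simp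
qed

definition remaining_cost ::
  "('a \<Rightarrow> real^'d) \<Rightarrow> nat \<Rightarrow> ('a \<Rightarrow> real^'d) \<Rightarrow> (nat \<Rightarrow> 'a \<Rightarrow> real^'d) \<Rightarrow> 'a \<Rightarrow> real" where
  "remaining_cost \<xi> t V W \<omega> = \<xi> \<omega> $ i1 +
     (\<Sum>s=t..T. C s (S s \<omega>) (W s \<omega> - lag t (\<lambda>\<omega>. risky i1 (V \<omega>)) W s \<omega>))"

lemma hedging_cost_eq:
  "hedging_cost \<xi> t V = ess_inf M (F t)
     ((\<lambda>W. ess_sup M (F t) {\<lambda>\<omega>. ereal (remaining_cost \<xi> t V W \<omega>)}) ` strategies t \<xi>)"
  unfolding hedging_cost_def remaining_cost_def by (simp add: Setcompr_eq_image)

lemma remaining_cost_first: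
  assumes "t < T" "W t \<omega> $ i1 = 0"
  shows "remaining_cost \<xi> t V W \<omega> =
    C t (S t \<omega>) (W t \<omega> - risky i1 (V \<omega>)) + remaining_cost \<xi> (Suc t) (W t) W \<omega>"
proof -
  have "(\<Sum>s=Suc t..T. C s (S s \<omega>) (W s \<omega> - lag t (\<lambda>\<omega>. risky i1 (V \<omega>)) W s \<omega>)) =
      (\<Sum>s=Suc t..T. C s (S s \<omega>) (W s \<omega> - lag (Suc t) (\<lambda>\<omega>. risky i1 (W t \<omega>)) W s \<omega>))"
    using assms(2) by (intro sum.cong) (auto simp: lag_def risky_eq)
  then show ?thesis
    using assms(1) by (simp add: remaining_cost_def sum.atLeast_Suc_atMost lag_def)
qed

lemma remaining_cost_cong:
  assumes "\<And>s. t \<le> s \<Longrightarrow> s \<le> T \<Longrightarrow> W s \<omega> = W' s \<omega>"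
  shows "remaining_cost \<xi> t V W \<omega> = remaining_cost \<xi> t V W' \<omega>"
proof -
  have "(\<Sum>s=t..T. C s (S s \<omega>) (W s \<omega> - lag t (\<lambda>\<omega>. risky i1 (V \<omega>)) W s \<omega>)) =
      (\<Sum>s=t..T. C s (S s \<omega>) (W' s \<omega> - lag t (\<lambda>\<omega>. risky i1 (V \<omega>)) W' s \<omega>))"
  proof (rule sum.cong[OF refl])
    fix s assume s: "s \<in> {t..T}"
    then have "s \<noteq> t \<Longrightarrow> W (s - 1) \<omega> = W' (s - 1) \<omega>" by (intro assms) auto
    with assms[of s] s
    show "C s (S s \<omega>) (W s \<omega> - lag t (\<lambda>\<omega>. risky i1 (V \<omega>)) W s \<omega>) =
        C s (S s \<omega>) (W' s \<omega> - lag t (\<lambda>\<omega>. risky i1 (V \<omega>)) W' s \<omega>)"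
      by (auto simp: lag_def)
  qed
  then show ?thesis by (simp add: remaining_cost_def)
qed

lemma strategies_nonempty: "strategies t \<xi> \<noteq> {}"
  unfolding strategies_def
  by (auto intro!: exI[of _ "\<lambda>s \<omega>. if s = T then risky i1 (\<xi> \<omega>) else 0"])

lemma strategies_paste:
  assumes W: "\<And>n::nat. W n \<in> strategies t \<xi>"
    and N: "N \<in> measurable (F t) (count_space UNIV)"
  shows "(\<lambda>s \<omega>. W (N \<omega>) s \<omega>) \<in> strategies t \<xi>"
proof -
  have "(\<lambda>\<omega>. W (N \<omega>) s \<omega>) \<in> borel_measurable (F s)" if "s \<in> {t..<T}" for s
  proof (rule measurable_compose_countable[where f="\<lambda>n. W n s" and g=N])
    show "W n s \<in> borel_measurable (F s)" for n using W[of n] that by (auto simp: strategies_def)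
    show "N \<in> measurable (F s) (count_space UNIV)" using F_mono_measurable[OF N] that by simp
  qed
  moreover have "W n T = (\<lambda>\<omega>. risky i1 (\<xi> \<omega>))" for n using W[of n] by (simp add: strategies_def)
  moreover have "W n s \<omega> $ i1 = 0" if "s \<in> {t..<T}" "\<omega> \<in> space M" for n s \<omega>
    using W[of n] that by (simp add: strategies_def)
  ultimately show ?thesis by (simp add: strategies_def)
qed

text \<open>Splitting off the trade at time \<open>t\<close>, a strategy is a position \<open>Z\<close> followed by a strategy
from time \<open>t + 1\<close> on. That the right-hand side is a lower bound follows from the tower property
of essential suprema. For the reverse inequality the essential infimum at time \<open>t + 1\<close> has to be
exchanged with the essential supremum at time \<open>t\<close>: for a fixed \<open>Z\<close>, on the event where the inner
essential supremum minus the cost of the trade is below a rational \<open>q\<close>, strategies from time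
\<open>t + 1\<close> on can be pasted into one whose remaining cost is below \<open>q\<close>.\<close>

lemma hedging_cost_dynamic_programming:
  assumes t: "t < T" and V [measurable]: "V \<in> borel_measurable (F t)"
  shows "AE \<omega> in M. hedging_cost \<xi> t V \<omega> = ess_inf M (F t)
    ((\<lambda>Z. ess_sup M (F t) {\<lambda>\<omega>. ereal (C t (S t \<omega>) (Z \<omega> - risky i1 (V \<omega>))) +
       hedging_cost \<xi> (Suc t) Z \<omega>}) ` selections (F t) risky_space) \<omega>"
    (is "AE \<omega> in M. _ = ess_inf M (F t) (?I ` _) \<omega>")
proof -
  interpret F: prob_subalgebra M "F t" by (rule prob_subalgebra_F)
  interpret F': prob_subalgebra M "F (Suc t)" by (rule prob_subalgebra_F)
  let ?sup = "\<lambda>W. ess_sup M (F t) {\<lambda>\<omega>. ereal (remaining_cost \<xi> t V W \<omega>)}"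
  let ?sup' = "\<lambda>Z W. ess_sup M (F (Suc t)) {\<lambda>\<omega>. ereal (remaining_cost \<xi> (Suc t) Z W \<omega>)}"
  have c: "(\<lambda>\<omega>. C t (S t \<omega>) (Z \<omega> - risky i1 (V \<omega>))) \<in> borel_measurable (F t)"
    if [measurable]: "Z \<in> borel_measurable (F t)" for Z
    using t by (intro cost_measurable) auto
  have "AE \<omega> in M. ess_inf M (F t) (?I ` selections (F t) risky_space) \<omega> \<le> hedging_cost \<xi> t V \<omega>"
    unfolding hedging_cost_eq[of \<xi> t V]
  proof (rule F.ess_inf_greatest[OF F.ess_inf_measurable])
    fix X assume "X \<in> ?sup ` strategies t \<xi>"
    then obtain W where W: "W \<in> strategies t \<xi>" and X: "X = ?sup W" by auto
    have Wt: "W t \<in> selections (F t) risky_space"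
      using W t by (auto simp: strategies_def selections_def space_F)
    note c[OF selections_measurable[OF Wt], measurable]
    let ?c = "\<lambda>\<omega>. C t (S t \<omega>) (W t \<omega> - risky i1 (V \<omega>))"
    have W': "W \<in> strategies (Suc t) \<xi>" using W by (auto simp: strategies_def)
    have eq: "AE \<omega> in M. remaining_cost \<xi> t V W \<omega> = ?c \<omega> + remaining_cost \<xi> (Suc t) (W t) W \<omega>"
      using selections_in[OF Wt] t by (intro AE_I2 remaining_cost_first) (auto simp: space_F)
    have "AE \<omega> in M. ?sup' (W t) W \<omega> \<le> ?sup W \<omega> - ereal (?c \<omega>)"
    proof (rule F'.ess_sup_least)
      have "(\<lambda>\<omega>. ?sup W \<omega> - ereal (?c \<omega>)) \<in> borel_measurable (F t)" by measurable
      then show "(\<lambda>\<omega>. ?sup W \<omega> - ereal (?c \<omega>)) \<in> borel_measurable (F (Suc t))"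
        by (rule F_mono_measurable) simp
      show "AE \<omega> in M. ereal (remaining_cost \<xi> (Suc t) (W t) W \<omega>) \<le> ?sup W \<omega> - ereal (?c \<omega>)"
        using eq F.ess_sup_upper[OF singletonI, of "\<lambda>\<omega>. ereal (remaining_cost \<xi> t V W \<omega>)"]
        by eventually_elim (simp add: ereal_add_le_iff[symmetric])
    qed
    moreover have "AE \<omega> in M. hedging_cost \<xi> (Suc t) (W t) \<omega> \<le> ?sup' (W t) W \<omega>"
      unfolding hedging_cost_eq[of \<xi> "Suc t"] using W' by (intro F'.ess_inf_lower imageI)
    ultimately have "AE \<omega> in M. ereal (?c \<omega>) + hedging_cost \<xi> (Suc t) (W t) \<omega> \<le> ?sup W \<omega>"
      by eventually_elim (simp add: ereal_add_le_iff)
    then have "AE \<omega> in M. ?I (W t) \<omega> \<le> ?sup W \<omega>"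
      by (rule F.ess_sup_least[OF F.ess_sup_measurable])
    moreover have "AE \<omega> in M. ess_inf M (F t) (?I ` selections (F t) risky_space) \<omega> \<le> ?I (W t) \<omega>"
      using Wt by (intro F.ess_inf_lower imageI)
    ultimately show "AE \<omega> in M. ess_inf M (F t) (?I ` selections (F t) risky_space) \<omega> \<le> X \<omega>"
      unfolding X by eventually_elim simp
  qed
  moreover have "AE \<omega> in M. hedging_cost \<xi> t V \<omega> \<le> ess_inf M (F t) (?I ` selections (F t) risky_space) \<omega>"
  proof (rule F.ess_inf_greatest)
    show "hedging_cost \<xi> t V \<in> borel_measurable (F t)" unfolding hedging_cost_eq by measurable
    fix X assume "X \<in> ?I ` selections (F t) risky_space"
    then obtain Z where Z: "Z \<in> selections (F t) risky_space" and X: "X = ?I Z" by auto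
    note Z_meas = selections_measurable[OF Z]
    note c[OF Z_meas, measurable]
    let ?c = "\<lambda>\<omega>. C t (S t \<omega>) (Z \<omega> - risky i1 (V \<omega>))"
    have le: "AE \<omega> in M. hedging_cost \<xi> (Suc t) Z \<omega> \<le> X \<omega> - ereal (?c \<omega>)"
      using F.ess_sup_upper[OF singletonI, of "\<lambda>\<omega>. ereal (?c \<omega>) + hedging_cost \<xi> (Suc t) Z \<omega>"]
      unfolding X by eventually_elim (simp add: ereal_add_le_iff)
    have "AE \<omega> in M. X \<omega> - ereal (?c \<omega>) < ereal q \<longrightarrow> hedging_cost \<xi> t V \<omega> \<le> ereal (?c \<omega> + q)" for q
    proof -
      define A where "A = {\<omega> \<in> space (F t). X \<omega> - ereal (?c \<omega>) < ereal q}"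
      have [measurable]: "X \<in> borel_measurable (F t)" unfolding X by measurable
      have A [measurable]: "A \<in> sets (F t)" unfolding A_def by measurable
      have "\<exists>W\<in>strategies (Suc t) \<xi>. AE \<omega> in M. \<omega> \<in> A \<longrightarrow> ?sup' Z W \<omega> < ereal q"
      proof (rule F'.ess_inf_selection)
        show "strategies (Suc t) \<xi> \<noteq> {}" by (rule strategies_nonempty)
        show "?sup' Z W \<in> borel_measurable (F (Suc t))" for W by (rule F'.ess_sup_measurable)
        show "\<exists>W\<in>strategies (Suc t) \<xi>. AE \<omega> in M. ?sup' Z W \<omega> = ?sup' Z (w (N \<omega>)) \<omega>"
          if w: "\<And>n::nat. w n \<in> strategies (Suc t) \<xi>"
            and N [measurable]: "N \<in> measurable (F (Suc t)) (count_space UNIV)" for w N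
        proof (rule bexI[OF _ strategies_paste[OF w N]])
          show "AE \<omega> in M. ?sup' Z (\<lambda>s \<omega>. w (N \<omega>) s \<omega>) \<omega> = ?sup' Z (w (N \<omega>)) \<omega>"
          proof (rule AE_countable_cases)
            fix n
            have "AE \<omega> in M. \<omega> \<in> {\<omega> \<in> space (F (Suc t)). N \<omega> = n} \<longrightarrow>
                ?sup' Z (\<lambda>s \<omega>. w (N \<omega>) s \<omega>) \<omega> = ?sup' Z (w n) \<omega>"
              by (rule F'.ess_sup_cong_on) (auto intro!: AE_I2 remaining_cost_cong)
            then show "AE \<omega> in M. N \<omega> = n \<longrightarrow> ?sup' Z (\<lambda>s \<omega>. w (N \<omega>) s \<omega>) \<omega> = ?sup' Z (w n) \<omega>"
              using AE_space by eventually_elim (auto simp: space_F)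
          qed
        qed
        show "AE \<omega> in M. \<omega> \<in> A \<longrightarrow> ess_inf M (F (Suc t)) (?sup' Z ` strategies (Suc t) \<xi>) \<omega> < ereal q"
          using le unfolding hedging_cost_eq[of \<xi> "Suc t"]
          by eventually_elim (auto simp: A_def intro: le_less_trans)
      qed
      then obtain W where W: "W \<in> strategies (Suc t) \<xi>"
        and Wq: "AE \<omega> in M. \<omega> \<in> A \<longrightarrow> ?sup' Z W \<omega> < ereal q" by auto
      let ?W = "W(t := Z)"
      have sel: "Z \<omega> $ i1 = 0" if "\<omega> \<in> space M" for \<omega>
        using selections_in[OF Z, of \<omega>] that by (simp add: space_F)
      have W': "?W \<in> strategies t \<xi>"
        using W t Z_meas sel by (auto simp: strategies_def)
      have "AE \<omega> in M. \<omega> \<in> A \<longrightarrow> ereal (remaining_cost \<xi> t V ?W \<omega>) \<le> ereal (?c \<omega> + q)"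
        using Wq F'.ess_sup_upper[OF singletonI, of "\<lambda>\<omega>. ereal (remaining_cost \<xi> (Suc t) Z W \<omega>)"] AE_space
      proof (eventually_elim, intro impI)
        fix \<omega> assume h: "\<omega> \<in> A \<longrightarrow> ?sup' Z W \<omega> < ereal q"
          "ereal (remaining_cost \<xi> (Suc t) Z W \<omega>) \<le> ?sup' Z W \<omega>" "\<omega> \<in> space M" "\<omega> \<in> A"
        then have "ereal (remaining_cost \<xi> (Suc t) Z W \<omega>) < ereal q"
          by (blast intro: le_less_trans)
        moreover have "remaining_cost \<xi> (Suc t) Z ?W \<omega> = remaining_cost \<xi> (Suc t) Z W \<omega>"
          by (rule remaining_cost_cong) auto
        ultimately show "ereal (remaining_cost \<xi> t V ?W \<omega>) \<le> ereal (?c \<omega> + q)"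
          using remaining_cost_first[of t ?W \<omega> \<xi> V] t sel[OF h(3)] by simp
      qed
      then have "AE \<omega> in M. \<omega> \<in> A \<longrightarrow> ?sup ?W \<omega> \<le> ereal (?c \<omega> + q)"
        by (intro F.ess_sup_least_on A) auto
      moreover have "AE \<omega> in M. hedging_cost \<xi> t V \<omega> \<le> ?sup ?W \<omega>"
        unfolding hedging_cost_eq[of \<xi> t V] using W' by (intro F.ess_inf_lower imageI)
      ultimately show ?thesis
        using AE_space by eventually_elim (auto simp: A_def space_F)
    qed
    then have "AE \<omega> in M. \<forall>q::rat. X \<omega> - ereal (?c \<omega>) < ereal (of_rat q) \<longrightarrow>
        hedging_cost \<xi> t V \<omega> \<le> ereal (?c \<omega> + of_rat q)"
      unfolding AE_all_countable by blast
    then show "AE \<omega> in M. hedging_cost \<xi> t V \<omega> \<le> X \<omega>"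
    proof eventually_elim
      case (elim \<omega>)
      show ?case
      proof (rule ccontr)
        assume "\<not> ?thesis"
        then have "X \<omega> - ereal (?c \<omega>) < hedging_cost \<xi> t V \<omega> - ereal (?c \<omega>)"
          by (cases "X \<omega>"; cases "hedging_cost \<xi> t V \<omega>") auto
        from ereal_dense3[OF this] obtain q where q: "X \<omega> - ereal (?c \<omega>) < ereal (of_rat q)"
          "ereal (of_rat q) < hedging_cost \<xi> t V \<omega> - ereal (?c \<omega>)" by blast
        from elim q(1) have "hedging_cost \<xi> t V \<omega> \<le> ereal (?c \<omega> + of_rat q)" by blast
        with q(2) show False by (cases "hedging_cost \<xi> t V \<omega>") auto
      qed
    qed
  qed
  ultimately show ?thesis by eventually_elim (rule antisym)
qed

end

section \<open>Coercivity from the enlarged market\<close>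

context cost_market
begin

text \<open>Backwards induction: at time \<open>T\<close> the payoff is nonnegative and \<open>C T\<close> is monotone, so
dropping the payoff only lowers the cost; at earlier times \<open>C_hat\<close> is below \<open>C\<close> and both
recursions are monotone.\<close>

lemma gamma_hat_zero_le_hedging_cost:
  assumes enlarged: "\<forall>u\<le>T. \<forall>s\<ge>0. \<forall>x. C_hat u s x \<le> ereal (C u s x)"
    and \<xi> [measurable]: "\<xi> \<in> borel_measurable (F T)" and \<xi>_nonneg: "\<And>\<omega>. 0 \<le> \<xi> \<omega>"
    and u: "u \<le> T" and V: "V \<in> borel_measurable (F u)"
  shows "AE \<omega> in M. gamma_hat (\<lambda>_. 0) u V \<omega> \<le> hedging_cost \<xi> u V \<omega>"
  using u V
proof (induction u arbitrary: V rule: inc_induct)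
  case base
  interpret F: prob_subalgebra M "F T" by (rule prob_subalgebra_F)
  note [measurable] = base
  let ?f = "\<lambda>\<omega>. \<xi> \<omega> $ i1 + C T (S T \<omega>) (risky i1 (\<xi> \<omega>) - risky i1 (V \<omega>))"
  have [measurable]: "(\<lambda>\<omega>. C T (S T \<omega>) (risky i1 (\<xi> \<omega>) - risky i1 (V \<omega>))) \<in> borel_measurable (F T)"
    by (rule cost_measurable) auto
  have [measurable]: "(\<lambda>\<omega>. \<xi> \<omega> $ i1) \<in> borel_measurable (F T)"
    by (rule borel_measurable_continuous_on[of "\<lambda>v. v $ i1"]) (intro continuous_intros, rule \<xi>)
  have "AE \<omega> in M. ereal (?f \<omega>) \<le> hedging_cost \<xi> T V \<omega>"
    unfolding hedging_cost_eq
  proof (rule F.ess_inf_greatest)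
    show "(\<lambda>\<omega>. ereal (?f \<omega>)) \<in> borel_measurable (F T)" by measurable
    fix X assume "X \<in> (\<lambda>W. ess_sup M (F T) {\<lambda>\<omega>. ereal (remaining_cost \<xi> T V W \<omega>)}) ` strategies T \<xi>"
    then obtain W where "W \<in> strategies T \<xi>"
      and X: "X = ess_sup M (F T) {\<lambda>\<omega>. ereal (remaining_cost \<xi> T V W \<omega>)}" by auto
    then have "remaining_cost \<xi> T V W = ?f"
      by (simp add: remaining_cost_def lag_def strategies_def fun_eq_iff)
    then show "AE \<omega> in M. ereal (?f \<omega>) \<le> X \<omega>"
      unfolding X using F.ess_sup_upper[OF singletonI, of "\<lambda>\<omega>. ereal (?f \<omega>)"] by simp
  qed
  then show ?case
    using AE_space
  proof eventually_elim
    case (elim \<omega>)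
    have s: "0 \<le> S T \<omega>" using S_nonneg[of T \<omega>] elim(2) by simp
    have "risky i1 (- V \<omega>) \<le> risky i1 (\<xi> \<omega>) - risky i1 (V \<omega>)"
      using \<xi>_nonneg[of \<omega>] by (simp add: less_eq_vec_def risky_nth)
    from C_mono[OF s this] have "C T (S T \<omega>) (risky i1 (- V \<omega>)) \<le> ?f \<omega>"
      using \<xi>_nonneg[of \<omega>] by (simp add: less_eq_vec_def add_increasing)
    then have "C_hat T (S T \<omega>) (risky i1 (- V \<omega>)) \<le> ereal (?f \<omega>)"
      using enlarged s by (meson ereal_less_eq(3) order_refl order_trans)
    also note elim(1)
    finally show ?case by (simp add: gamma_hat_T)
  qed
next
  case (step t)
  interpret F: prob_subalgebra M "F t" by (rule prob_subalgebra_F)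
  note V = step.prems
  have t: "t < T" by fact
  let ?I = "\<lambda>Z. ess_sup M (F t) {\<lambda>\<omega>. ereal (C t (S t \<omega>) (Z \<omega> - risky i1 (V \<omega>))) +
      hedging_cost \<xi> (Suc t) Z \<omega>}"
  have "AE \<omega> in M. gamma_hat (\<lambda>_. 0) t V \<omega> \<le> ess_inf M (F t) (?I ` selections (F t) risky_space) \<omega>"
  proof (rule F.ess_inf_greatest)
    show "gamma_hat (\<lambda>_. 0) t V \<in> borel_measurable (F t)"
      unfolding gamma_hat_less[OF t] by measurable
    fix X assume "X \<in> ?I ` selections (F t) risky_space"
    then obtain Z where Z: "Z \<in> selections (F t) risky_space" and X: "X = ?I Z" by auto
    note [measurable] = selections_measurable[OF Z] V
    let ?c = "\<lambda>\<omega>. C t (S t \<omega>) (Z \<omega> - risky i1 (V \<omega>))"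
    have [measurable]: "?c \<in> borel_measurable (F t)" using t by (intro cost_measurable) auto
    have IH: "AE \<omega> in M. gamma_hat (\<lambda>_. 0) (Suc t) Z \<omega> \<le> hedging_cost \<xi> (Suc t) Z \<omega>"
      by (rule step.IH) (rule F_mono_measurable[OF selections_measurable[OF Z]], simp)
    have "AE \<omega> in M. theta_hat (\<lambda>_. 0) t Z \<omega> \<le> X \<omega> - ereal (?c \<omega>)"
      unfolding theta_hat_def
    proof (rule F.ess_sup_least)
      show "(\<lambda>\<omega>. X \<omega> - ereal (?c \<omega>)) \<in> borel_measurable (F t)" unfolding X by measurable
      show "AE \<omega> in M. gamma_hat (\<lambda>_. 0) (Suc t) Z \<omega> \<le> X \<omega> - ereal (?c \<omega>)"
        using IH F.ess_sup_upper[OF singletonI, of "\<lambda>\<omega>. ereal (?c \<omega>) + hedging_cost \<xi> (Suc t) Z \<omega>"]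
        unfolding X ereal_add_le_iff by eventually_elim (rule order_trans)
    qed
    moreover have "AE \<omega> in M. gamma_hat (\<lambda>_. 0) t V \<omega> \<le>
        D_hat t (theta_hat (\<lambda>_. 0) t Z \<omega>) (S t \<omega>) (V \<omega>) (Z \<omega>)"
      unfolding gamma_hat_less[OF t] by (rule F.ess_inf_lower) auto
    ultimately show "AE \<omega> in M. gamma_hat (\<lambda>_. 0) t V \<omega> \<le> X \<omega>"
      using AE_space
    proof eventually_elim
      case (elim \<omega>)
      have "risky i1 (Z \<omega> - V \<omega>) = Z \<omega> - risky i1 (V \<omega>)"
        using selections_in[OF Z, of \<omega>] elim(3) by (simp add: vec_eq_iff risky_nth space_F)
      then have "C_hat t (S t \<omega>) (risky i1 (Z \<omega> - V \<omega>)) \<le> ereal (?c \<omega>)"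
        using enlarged t S_nonneg[of t \<omega>] elim(3) by auto
      then have "D_hat t (theta_hat (\<lambda>_. 0) t Z \<omega>) (S t \<omega>) (V \<omega>) (Z \<omega>) \<le>
          ereal (?c \<omega>) + theta_hat (\<lambda>_. 0) t Z \<omega>"
        unfolding D_hat_def by (rule add_right_mono)
      also have "\<dots> \<le> X \<omega>" using elim(1) by (simp add: ereal_add_le_iff)
      finally show ?case using elim(2) by (rule order_trans[rotated])
    qed
  qed
  with hedging_cost_dynamic_programming[OF t V, of \<xi>] show ?case by eventually_elim simp
qed

lemma theta_hat_superhomogeneous:
  assumes t: "t < T"
    and gamma: "AE \<omega> in M. ereal (d \<omega>) * gamma_hat g (Suc t) V \<omega> \<le> gamma_hat g (Suc t) V' \<omega>"
    and [measurable]: "d \<in> borel_measurable (F t)" and d: "\<And>\<omega>. 0 < d \<omega>"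
  shows "AE \<omega> in M. ereal (d \<omega>) * theta_hat g t V \<omega> \<le> theta_hat g t V' \<omega>"
proof -
  interpret F: prob_subalgebra M "F t" by (rule prob_subalgebra_F)
  have "AE \<omega> in M. theta_hat g t V \<omega> \<le> ereal (inverse (d \<omega>)) * theta_hat g t V' \<omega>"
    unfolding theta_hat_def
  proof (rule F.ess_sup_least)
    show "(\<lambda>\<omega>. ereal (inverse (d \<omega>)) * ess_sup M (F t) {gamma_hat g (Suc t) V'} \<omega>)
        \<in> borel_measurable (F t)" by measurable
    show "AE \<omega> in M. gamma_hat g (Suc t) V \<omega> \<le>
        ereal (inverse (d \<omega>)) * ess_sup M (F t) {gamma_hat g (Suc t) V'} \<omega>"
      using gamma F.ess_sup_upper[OF singletonI, of "gamma_hat g (Suc t) V'"]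
      by eventually_elim (simp add: ereal_mult_le_iff[OF d, symmetric])
  qed
  then show ?thesis by eventually_elim (simp add: ereal_mult_le_iff[OF d])
qed

text \<open>With the zero payoff every ingredient of the recursion scales: rescaling the start \<open>V\<close> by
\<open>l\<close> and the next position by \<open>l\<close> multiplies each cost at least by \<open>d\<close>. The factors are random
but known at time \<open>u\<close>, hence at all later times, so they pass through all the conditional
essential extrema.\<close>

lemma gamma_hat_zero_superhomogeneous:
  assumes hom: "\<And>u s x \<omega>. u \<le> T \<Longrightarrow> 0 \<le> s \<Longrightarrow>
      ereal (d \<omega>) * C_hat u s x \<le> C_hat u s (l \<omega> *\<^sub>R x)"
    and d: "\<And>\<omega>. 0 < d \<omega>" and l: "\<And>\<omega>. 0 < l \<omega>"
    and u: "u \<le> T" and meas: "d \<in> borel_measurable (F u)" "l \<in> borel_measurable (F u)"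
      "V \<in> borel_measurable (F u)"
  shows "AE \<omega> in M. ereal (d \<omega>) * gamma_hat (\<lambda>_. 0) u V \<omega> \<le>
    gamma_hat (\<lambda>_. 0) u (\<lambda>\<omega>. l \<omega> *\<^sub>R V \<omega>) \<omega>"
  using u meas
proof (induction u arbitrary: V rule: inc_induct)
  case base
  have "ereal (d \<omega>) * gamma_hat (\<lambda>_. 0) T V \<omega> \<le>
      gamma_hat (\<lambda>_. 0) T (\<lambda>\<omega>. l \<omega> *\<^sub>R V \<omega>) \<omega>" if "\<omega> \<in> space M" for \<omega>
    using hom[of T "S T \<omega>" \<omega> "risky i1 (- V \<omega>)"] S_nonneg[OF order_refl that]
    by (simp add: gamma_hat_T risky_scaleR[symmetric])
  then show ?case by (rule AE_I2)
next
  case (step t)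
  interpret F: prob_subalgebra M "F t" by (rule prob_subalgebra_F)
  have t: "t < T" by fact
  note [measurable] = step.prems
  let ?V = "\<lambda>\<omega>. l \<omega> *\<^sub>R V \<omega>"
  have gamma_meas [measurable]: "gamma_hat (\<lambda>_. 0) t V \<in> borel_measurable (F t)"
    unfolding gamma_hat_less[OF t] by measurable
  show ?case
    unfolding gamma_hat_less[OF t, of _ ?V]
  proof (rule F.ess_inf_greatest)
    show "(\<lambda>\<omega>. ereal (d \<omega>) * gamma_hat (\<lambda>_. 0) t V \<omega>) \<in> borel_measurable (F t)" by measurable
    fix X assume "X \<in> {\<lambda>\<omega>. D_hat t (theta_hat (\<lambda>_. 0) t W \<omega>) (S t \<omega>) (?V \<omega>) (W \<omega>)
      | W. W \<in> borel_measurable (F t)}"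
    then obtain W where W [measurable]: "W \<in> borel_measurable (F t)"
      and X: "X = (\<lambda>\<omega>. D_hat t (theta_hat (\<lambda>_. 0) t W \<omega>) (S t \<omega>) (?V \<omega>) (W \<omega>))" by auto
    \<comment> \<open>every position \<open>W\<close> competing for the scaled start is a scaled position \<open>Y\<close> for the original one\<close>
    define Y where "Y \<omega> = inverse (l \<omega>) *\<^sub>R W \<omega>" for \<omega>
    have Y [measurable]: "Y \<in> borel_measurable (F t)" unfolding Y_def by measurable
    have WY: "W = (\<lambda>\<omega>. l \<omega> *\<^sub>R Y \<omega>)" using l by (simp add: Y_def fun_eq_iff less_imp_neq[symmetric])
    have "AE \<omega> in M. ereal (d \<omega>) * gamma_hat (\<lambda>_. 0) (Suc t) Y \<omega> \<le> gamma_hat (\<lambda>_. 0) (Suc t) W \<omega>"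
      unfolding WY using step.prems Y
      by (intro step.IH) (simp_all add: F_mono_measurable[OF _ le_SucI[OF order_refl]])
    then have "AE \<omega> in M. ereal (d \<omega>) * theta_hat (\<lambda>_. 0) t Y \<omega> \<le> theta_hat (\<lambda>_. 0) t W \<omega>"
      using t d by (intro theta_hat_superhomogeneous) auto
    moreover have "AE \<omega> in M. gamma_hat (\<lambda>_. 0) t V \<omega> \<le>
        D_hat t (theta_hat (\<lambda>_. 0) t Y \<omega>) (S t \<omega>) (V \<omega>) (Y \<omega>)"
      unfolding gamma_hat_less[OF t] using Y by (intro F.ess_inf_lower) auto
    ultimately show "AE \<omega> in M. ereal (d \<omega>) * gamma_hat (\<lambda>_. 0) t V \<omega> \<le> X \<omega>"
      using AE_space
    proof eventually_elim
      case (elim \<omega>)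
      have "ereal (d \<omega>) * gamma_hat (\<lambda>_. 0) t V \<omega> \<le>
          ereal (d \<omega>) * D_hat t (theta_hat (\<lambda>_. 0) t Y \<omega>) (S t \<omega>) (V \<omega>) (Y \<omega>)"
        using elim(2) d[of \<omega>] by (intro ereal_mult_left_mono) auto
      also have "\<dots> = ereal (d \<omega>) * C_hat t (S t \<omega>) (risky i1 (Y \<omega> - V \<omega>)) +
          ereal (d \<omega>) * theta_hat (\<lambda>_. 0) t Y \<omega>"
        unfolding D_hat_def by (rule ereal_mult_add_distrib[OF d])
      also have "\<dots> \<le> C_hat t (S t \<omega>) (l \<omega> *\<^sub>R risky i1 (Y \<omega> - V \<omega>)) + theta_hat (\<lambda>_. 0) t W \<omega>"
        using elim(1,3) t S_nonneg[of t \<omega>] by (intro add_mono hom) auto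
      also have "\<dots> = X \<omega>"
        unfolding X D_hat_def by (simp add: WY risky_scaleR[symmetric] scaleR_diff_right)
      finally show ?case .
    qed
  qed
qed

text \<open>Super-additivity bounds the change by \<open>C t s (- v n)\<close>, sub-additivity by \<open>C t s (v n)\<close>;
both are controlled by the continuous bound of \<open>C t s\<close> on a ball.\<close>

lemma cost_perturbation_bounded:
  assumes t: "t \<le> T" and s: "0 \<le> s"
    and add: "super_additive_cost (\<lambda>s z. ereal (C t s z)) \<or> sub_additive_cost (\<lambda>s z. ereal (C t s z))"
    and bdd: "bounded (range v)"
  shows "\<exists>K. \<forall>n z. C t s z \<le> C t s (z - v n) + K"
proof -
  obtain B where B: "\<And>n. norm (v n) \<le> B" using bdd by (auto simp: bounded_iff)
  obtain h where h: "continuous_on UNIV h" "\<And>x. \<bar>C t s x\<bar> \<le> h (s, x)"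
    using C_bound[OF t] s by metis
  have "compact ((\<lambda>x. h (s, x)) ` cball 0 B)"
    by (intro compact_continuous_image continuous_on_compose2[OF h(1)] continuous_intros) auto
  then have "bounded ((\<lambda>x. h (s, x)) ` cball 0 B)" by (rule compact_imp_bounded)
  then obtain K where K: "\<forall>y\<in>(\<lambda>x. h (s, x)) ` cball 0 B. norm y \<le> K"
    unfolding bounded_iff by blast
  have CK: "\<bar>C t s x\<bar> \<le> K" if "norm x \<le> B" for x
  proof -
    have "norm (h (s, x)) \<le> K" using K that by auto
    with h(2)[of x] show ?thesis by auto
  qed
  have "C t s z \<le> C t s (z - v n) + K" for n z
    using add
  proof
    assume "super_additive_cost (\<lambda>s z. ereal (C t s z))"
    then have "C t s z + C t s (- v n) \<le> C t s (z + (- v n))"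
      using s by (auto simp: super_additive_cost_def simp del: add_uminus_conv_diff)
    then show ?thesis using CK[of "- v n"] B[of n] by auto
  next
    assume "sub_additive_cost (\<lambda>s z. ereal (C t s z))"
    then have "C t s (z - v n + v n) \<le> C t s (z - v n) + C t s (v n)"
      using s unfolding sub_additive_cost_def by (metis ereal_less_eq(3) plus_ereal.simps(1))
    then show ?thesis using CK[of "v n"] B[of n] by auto
  qed
  then show ?thesis by blast
qed

text \<open>Writing \<open>Z n = l n *\<^sub>R Y n\<close> with \<open>l n = max 1 (norm (Z n))\<close>, the value of \<open>D_hat\<close> at \<open>Z n\<close>
is at least \<open>\<delta> (l n)\<close> times its value at \<open>Y n\<close>. Where \<open>norm (Z n)\<close> exceeds 1, \<open>Y n\<close> lies on the
unit sphere, so the latter value is bounded below by a positive constant. The assumed upper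
bound on the costs then bounds \<open>\<delta> (l n)\<close>, hence \<open>l n\<close>.\<close>

lemma hedging_positions_bounded:
  fixes Z :: "nat \<Rightarrow> 'a \<Rightarrow> real^'d" and U :: "nat \<Rightarrow> 'a \<Rightarrow> real^'d"
  assumes t: "t < T"
    and enlarged: "\<forall>u\<le>T. \<forall>s\<ge>0. \<forall>x. C_hat u s x \<le> ereal (C u s x)"
    and delta: "bij \<delta>" "mono \<delta>" "\<delta> 0 = 0" "\<delta> \<infinity> = \<infinity>"
    and homogeneous: "\<forall>u\<le>T. super_homogeneous_cost \<delta> (C_hat u)"
    and \<xi>: "\<xi> \<in> borel_measurable (F T)" "\<And>\<omega>. 0 \<le> \<xi> \<omega>"
    and additive:
      "super_additive_cost (\<lambda>s z. ereal (C t s z)) \<or> sub_additive_cost (\<lambda>s z. ereal (C t s z))"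
    and theta: "represents_theta_hat (\<lambda>_. 0) t \<Theta>"
    and positive: "AE \<omega> in M.
      (INF z\<in>{z. z $ i1 = 0 \<and> norm z = 1}. D_hat t (\<Theta> \<omega> z) (S t \<omega>) 0 z) > 0"
    and U [measurable]: "\<And>n. U n \<in> borel_measurable (F t)"
    and Z: "\<And>n. Z n \<in> selections (F t) risky_space"
    and A [measurable]: "A \<in> sets (F t)"
    and lim: "\<And>\<omega>. \<omega> \<in> A \<Longrightarrow> (\<lambda>n. U n \<omega>) \<longlonglongrightarrow> V \<omega>"
    and le: "\<And>n. AE \<omega> in M. \<omega> \<in> A \<longrightarrow>
      ereal (C t (S t \<omega>) (Z n \<omega> - risky i1 (U n \<omega>))) + hedging_cost \<xi> (Suc t) (Z n) \<omega> \<le> ereal q"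
  shows "AE \<omega> in M. \<omega> \<in> A \<longrightarrow> bounded (range (\<lambda>n. Z n \<omega>))"
proof -
  interpret F: prob_subalgebra M "F t" by (rule prob_subalgebra_F)
  have Z_meas [measurable]: "Z n \<in> borel_measurable (F t)" for n using Z by (rule selections_measurable)
  let ?c = "\<lambda>n \<omega>. C t (S t \<omega>) (Z n \<omega> - risky i1 (U n \<omega>))"
  have [measurable]: "?c n \<in> borel_measurable (F t)" for n using t by (intro cost_measurable) auto
  have \<Theta>: "AE \<omega> in M. \<Theta> \<omega> (W \<omega>) = theta_hat (\<lambda>_. 0) t W \<omega>" if "W \<in> borel_measurable (F t)" for W
    using theta that by (simp add: represents_theta_hat_def)
  have theta_le: "AE \<omega> in M. \<omega> \<in> A \<longrightarrow> ereal (?c n \<omega>) + theta_hat (\<lambda>_. 0) t (Z n) \<omega> \<le> ereal q" for n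
  proof -
    have "AE \<omega> in M. gamma_hat (\<lambda>_. 0) (Suc t) (Z n) \<omega> \<le> hedging_cost \<xi> (Suc t) (Z n) \<omega>"
      using t F_mono_measurable[OF Z_meas]
      by (intro gamma_hat_zero_le_hedging_cost[OF enlarged \<xi>]) auto
    with le[of n] have "AE \<omega> in M. \<omega> \<in> A \<longrightarrow>
        gamma_hat (\<lambda>_. 0) (Suc t) (Z n) \<omega> \<le> ereal q - ereal (?c n \<omega>)"
      unfolding ereal_add_le_iff by eventually_elim (blast intro: order_trans)
    then have "AE \<omega> in M. \<omega> \<in> A \<longrightarrow> theta_hat (\<lambda>_. 0) t (Z n) \<omega> \<le> ereal q - ereal (?c n \<omega>)"
      unfolding theta_hat_def by (intro F.ess_sup_least_on A) measurable
    then show ?thesis by (simp add: ereal_add_le_iff)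
  qed
  \<comment> \<open>\<open>\<delta>\<close> is finite and positive on \<open>[1, \<infinity>)\<close>; its real-valued version there is monotone, hence Borel\<close>
  define \<delta>' where "\<delta>' r = enn2real (\<delta> (ennreal (max 1 r)))" for r :: real
  have \<delta>_less_top: "\<delta> (ennreal r) \<noteq> top" for r
    using delta(1,4) by (metis bij_pointE ennreal_neq_top infinity_ennreal_def)
  have \<delta>'_eq: "enn2ereal (\<delta> (ennreal r)) = ereal (\<delta>' r)" if "1 \<le> r" for r
    using that \<delta>_less_top[of r] unfolding \<delta>'_def
    by (cases "\<delta> (ennreal r)") (auto simp: max_def enn2ereal_ennreal)
  have \<delta>'_pos: "0 < \<delta>' r" for r
  proof -
    have "\<delta> (ennreal (max 1 r)) \<noteq> 0"
      using delta(1,3) by (metis bij_pointE ennreal_eq_0_iff max.cobounded1 not_one_le_zero order_trans)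
    then show ?thesis
      using \<delta>_less_top[of "max 1 r"] by
        (simp add: \<delta>'_def enn2real_positive_iff less_top zero_less_iff_neq_zero)
  qed
  have "mono \<delta>'"
    unfolding \<delta>'_def using \<delta>_less_top
    by (intro monoI enn2real_mono monoD[OF delta(2)] ennreal_leI) (auto simp: less_top)
  then have [measurable]: "\<delta>' \<in> borel_measurable borel" by (rule borel_measurable_mono)
  define l where "l n \<omega> = max 1 (norm (Z n \<omega>))" for n \<omega>
  define Y where "Y n \<omega> = inverse (l n \<omega>) *\<^sub>R Z n \<omega>" for n \<omega>
  have l: "1 \<le> l n \<omega>" "0 < l n \<omega>" for n \<omega> by (auto simp: l_def)
  have l_meas [measurable]: "l n \<in> borel_measurable (F t)" for n unfolding l_def by measurable
  have Y [measurable]: "Y n \<in> borel_measurable (F t)" for n unfolding Y_def by measurable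
  have ZY: "Z n \<omega> = l n \<omega> *\<^sub>R Y n \<omega>" for n \<omega> using l(2)[of n \<omega>] by (simp add: Y_def)
  have hom: "ereal (\<delta>' (l n \<omega>)) * C_hat u s x \<le> C_hat u s (l n \<omega> *\<^sub>R x)"
    if "u \<le> T" "0 \<le> s" for u s x n \<omega>
    using homogeneous that l(1)[of n \<omega>] by (auto simp: super_homogeneous_cost_def \<delta>'_eq[symmetric])
  have theta_hom: "AE \<omega> in M. ereal (\<delta>' (l n \<omega>)) * theta_hat (\<lambda>_. 0) t (Y n) \<omega> \<le>
      theta_hat (\<lambda>_. 0) t (Z n) \<omega>" for n
  proof (rule theta_hat_superhomogeneous[OF t])
    have "Z n = (\<lambda>\<omega>. l n \<omega> *\<^sub>R Y n \<omega>)" by (simp add: ZY fun_eq_iff)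
    then show "AE \<omega> in M. ereal (\<delta>' (l n \<omega>)) * gamma_hat (\<lambda>_. 0) (Suc t) (Y n) \<omega> \<le>
        gamma_hat (\<lambda>_. 0) (Suc t) (Z n) \<omega>"
      using t hom \<delta>'_pos l(2) F_mono_measurable[OF Y] F_mono_measurable[OF l_meas]
      by (simp only:) (intro gamma_hat_zero_superhomogeneous, auto)
  qed (auto simp: \<delta>'_pos)
  have "AE \<omega> in M. \<forall>n. (\<omega> \<in> A \<longrightarrow> ereal (?c n \<omega>) + theta_hat (\<lambda>_. 0) t (Z n) \<omega> \<le> ereal q) \<and>
      ereal (\<delta>' (l n \<omega>)) * theta_hat (\<lambda>_. 0) t (Y n) \<omega> \<le> theta_hat (\<lambda>_. 0) t (Z n) \<omega> \<and>
      \<Theta> \<omega> (Y n \<omega>) = theta_hat (\<lambda>_. 0) t (Y n) \<omega>"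
    unfolding AE_all_countable by (intro allI AE_conjI theta_le theta_hom \<Theta> Y)
  with positive AE_space show ?thesis
  proof (eventually_elim, intro impI)
    fix \<omega>
    let ?D = "\<lambda>z. D_hat t (\<Theta> \<omega> z) (S t \<omega>) 0 z"
    assume inf: "0 < (INF z\<in>{z. z $ i1 = 0 \<and> norm z = 1}. ?D z)" and \<omega>: "\<omega> \<in> space M" "\<omega> \<in> A"
    assume bounds: "\<forall>n. (\<omega> \<in> A \<longrightarrow> ereal (?c n \<omega>) + theta_hat (\<lambda>_. 0) t (Z n) \<omega> \<le> ereal q) \<and>
      ereal (\<delta>' (l n \<omega>)) * theta_hat (\<lambda>_. 0) t (Y n) \<omega> \<le> theta_hat (\<lambda>_. 0) t (Z n) \<omega> \<and>
      \<Theta> \<omega> (Y n \<omega>) = theta_hat (\<lambda>_. 0) t (Y n) \<omega>"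
    have s: "0 \<le> S t \<omega>" using S_nonneg[of t \<omega>] t \<omega> by simp
    \<comment> \<open>the infimum may be \<open>\<infinity>\<close>, for instance when the sphere is empty, so a real number below it is used\<close>
    obtain c where c: "0 < ereal c" "ereal c < (INF z\<in>{z. z $ i1 = 0 \<and> norm z = 1}. ?D z)"
      using ereal_dense2[OF inf] by auto
    have "(\<lambda>n. risky i1 (U n \<omega>)) \<longlonglongrightarrow> risky i1 (V \<omega>)"
      unfolding risky_def by (intro tendsto_intros lim \<omega>)
    then have "bounded (range (\<lambda>n. risky i1 (U n \<omega>)))" by (rule convergent_imp_bounded)
    then obtain K where K: "\<And>n z. C t (S t \<omega>) z \<le> C t (S t \<omega>) (z - risky i1 (U n \<omega>)) + K"
      using cost_perturbation_bounded[OF _ s additive] t by fastforce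
    \<comment> \<open>the level that \<open>\<delta>\<close> must not exceed; surjectivity of \<open>\<delta>\<close> turns it into a bound \<open>r\<close> on the norms\<close>
    define b where "b = max 0 ((q + K) / c) + 1"
    have b: "0 \<le> b" "(q + K) / c < b" by (auto simp: b_def)
    obtain x where x: "\<delta> x = ennreal b"
      using delta(1) by (metis bij_pointE)
    then have "x \<noteq> top" using delta(4) by (metis ennreal_neq_top infinity_ennreal_def)
    then obtain r where r: "x = ennreal r" "0 \<le> r" by (cases x) auto
    have "norm (Z n \<omega>) \<le> max 1 r" for n
    proof (rule ccontr)
      assume "\<not> ?thesis"
      then have big: "1 < norm (Z n \<omega>)" "r < norm (Z n \<omega>)" by auto
      then have l_eq: "l n \<omega> = norm (Z n \<omega>)" by (simp add: l_def)
      have Zi: "Z n \<omega> $ i1 = 0" using selections_in[OF Z, of \<omega> n] \<omega> by (simp add: space_F)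
      have Y1: "Y n \<omega> $ i1 = 0" "norm (Y n \<omega>) = 1"
      proof -
        have "norm (Z n \<omega>) \<noteq> 0" using big by linarith
        then show "norm (Y n \<omega>) = 1" by (simp add: Y_def l_eq del: norm_eq_zero)
      qed (simp add: Y_def Zi)
      have "ereal c \<le> ?D (Y n \<omega>)"
        using c(2) Y1 by (intro less_imp_le[OF less_le_trans[OF c(2)]] INF_lower) auto
      then have "ereal (\<delta>' (l n \<omega>)) * ereal c \<le> ereal (\<delta>' (l n \<omega>)) * ?D (Y n \<omega>)"
        using \<delta>'_pos[of "l n \<omega>"] by (intro ereal_mult_left_mono) auto
      also have "\<dots> = ereal (\<delta>' (l n \<omega>)) * C_hat t (S t \<omega>) (Y n \<omega>) +
          ereal (\<delta>' (l n \<omega>)) * theta_hat (\<lambda>_. 0) t (Y n) \<omega>"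
        using bounds Y1 by (simp add: D_hat_def risky_eq ereal_mult_add_distrib[OF \<delta>'_pos])
      also have "\<dots> \<le> C_hat t (S t \<omega>) (Z n \<omega>) + theta_hat (\<lambda>_. 0) t (Z n) \<omega>"
        using hom[of t "S t \<omega>" n \<omega> "Y n \<omega>"] t s bounds by (intro add_mono) (auto simp: ZY[symmetric])
      also have "\<dots> \<le> ereal (?c n \<omega> + K) + theta_hat (\<lambda>_. 0) t (Z n) \<omega>"
      proof (rule add_right_mono)
        have "C_hat t (S t \<omega>) (Z n \<omega>) \<le> ereal (C t (S t \<omega>) (Z n \<omega>))" using enlarged t s by auto
        also have "\<dots> \<le> ereal (?c n \<omega> + K)" using K by simp
        finally show "C_hat t (S t \<omega>) (Z n \<omega>) \<le> ereal (?c n \<omega> + K)" .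
      qed
      also have "\<dots> \<le> ereal (q + K)"
        using bounds[rule_format, of n] \<omega>(2) by (cases "theta_hat (\<lambda>_. 0) t (Z n) \<omega>") auto
      finally have "\<delta>' (l n \<omega>) * c \<le> q + K" by simp
      then have "\<delta>' (l n \<omega>) \<le> (q + K) / c" using c(1) by (simp add: field_simps)
      moreover have "b \<le> \<delta>' (l n \<omega>)"
      proof -
        have "\<delta> x \<le> \<delta> (ennreal (l n \<omega>))"
          unfolding r(1) l_eq using big by (intro monoD[OF delta(2)] ennreal_leI) simp
        then have "enn2ereal (\<delta> x) \<le> ereal (\<delta>' (l n \<omega>))"
          unfolding \<delta>'_eq[OF l(1), symmetric] by (simp add: less_eq_ennreal.rep_eq)
        then show ?thesis unfolding x by (simp add: enn2ereal_ennreal b(1))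
      qed
      ultimately show False using b(2) by linarith
    qed
    then show "bounded (range (\<lambda>n. Z n \<omega>))" by (auto simp: bounded_iff)
  qed
qed

end

section \<open>The hedging cost as a normal integrand\<close>

theorem theorem4p19:
  fixes M :: "'a measure" and F :: "nat \<Rightarrow> 'a measure" and T t :: nat
    and S :: "nat \<Rightarrow> 'a \<Rightarrow> real^'m" and C :: "nat \<Rightarrow> real^'m \<Rightarrow> real^'d \<Rightarrow> real" and i1 :: 'd
    and \<delta> :: "ennreal \<Rightarrow> ennreal"
    and g :: "real^'m \<Rightarrow> real^'d" and \<xi> :: "'a \<Rightarrow> real^'d"
    and \<gamma>' :: "'a \<Rightarrow> (real^'m) \<times> (real^'d) \<Rightarrow> ereal"
    and \<phi> :: "nat \<Rightarrow> real^'m \<Rightarrow> (real^'m) set" and R :: "nat \<Rightarrow> real^'m \<Rightarrow> real"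
    and \<Theta> :: "'a \<Rightarrow> real^'d \<Rightarrow> ereal"
  assumes market: "cost_market M F T S C i1"
    and t: "t < T"
    and enlarged: "\<forall>u\<le>T. \<forall>s\<ge>0. \<forall>x. cost_market.C_hat C u s x \<le> ereal (C u s x)"
    and delta: "bij \<delta>" "mono \<delta>" "\<delta> 0 = 0" "\<delta> \<infinity> = \<infinity>"
    and homogeneous: "\<forall>u\<le>T. super_homogeneous_cost \<delta> (cost_market.C_hat C u)"
    and additive_hat:
      "(\<forall>u\<le>T. sub_additive_cost (cost_market.C_hat C u)) \<or>
       (\<forall>u\<le>T. super_additive_cost (cost_market.C_hat C u))"
    and next_integrand: "normal_integrand (F (t + 1)) \<gamma>'"
    and next_cost: "\<forall>V\<in>borel_measurable (F t). AE \<omega> in M.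
      cost_market.hedging_cost M F T S C i1 \<xi> (t + 1) V \<omega> = \<gamma>' \<omega> (S (t + 1) \<omega>, V \<omega>)"
    and payoff: "\<xi> = (\<lambda>\<omega>. g (S T \<omega>))" "continuous_on UNIV g" "\<forall>s. 0 \<le> g s"
    and hedge: "cost_market.hedgeable M F T S C i1 \<xi>"
    and support: "\<forall>u<T. is_cond_support M (F u) (S (u + 1)) (\<lambda>\<omega>. \<phi> u (S u \<omega>))"
    and phi: "\<forall>u<T. lower_hemicontinuous (\<phi> u) \<and> (\<forall>s. compact (\<phi> u s))"
    and R: "\<forall>u<T. continuous_on UNIV (R u) \<and> (AE \<omega> in M. \<phi> u (S u \<omega>) \<subseteq> cball 0 (R u (S u \<omega>)))"
    and C_integrand: "normal_integrand (F t) (\<lambda>\<omega> (s, z). ereal (C t s z))"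
    and C_additive:
      "super_additive_cost (\<lambda>s z. ereal (C t s z)) \<or> sub_additive_cost (\<lambda>s z. ereal (C t s z))"
    and theta: "cost_market.represents_theta_hat M F T S C i1 (\<lambda>_. 0) t \<Theta>"
    and positive: "AE \<omega> in M.
      (INF z\<in>{z. z $ i1 = 0 \<and> norm z = 1}. cost_market.D_hat C i1 t (\<Theta> \<omega> z) (S t \<omega>) 0 z) > 0"
  shows "\<exists>\<gamma>::'a \<Rightarrow> (real^'m) \<times> (real^'d) \<Rightarrow> ereal. normal_integrand (F t) \<gamma> \<and>
    (\<forall>V\<in>borel_measurable (F t). AE \<omega> in M.
       cost_market.hedging_cost M F T S C i1 \<xi> t V \<omega> = \<gamma> \<omega> (S t \<omega>, V \<omega>))"
proof -
  interpret cost_market M F T S C i1 by (rule market)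
  interpret F: prob_subalgebra M "F t" by (rule prob_subalgebra_F)
  have \<xi>: "\<xi> \<in> borel_measurable (F T)"
    unfolding payoff(1) using payoff(2) S_adapted by (rule borel_measurable_continuous_on) simp
  have \<xi>_nonneg: "0 \<le> \<xi> \<omega>" for \<omega> using payoff(1,3) by simp
  have next_eq: "AE \<omega> in M. \<omega> \<in> A \<longrightarrow>
      hedging_cost \<xi> (Suc t) Z \<omega> = \<gamma>' \<omega> (S (Suc t) \<omega>, Z \<omega>)" if "Z \<in> selections (F t) K" for Z K A
    using next_cost selections_measurable[OF that] by (auto elim: eventually_mono)
  define J where "J \<omega> = (\<lambda>(v, z). ereal (C t (S t \<omega>) (z - risky i1 v)) + \<gamma>' \<omega> (S (Suc t) \<omega>, z))" for \<omega>
  have "\<exists>h. normal_integrand (F t) h \<and> (\<forall>V\<in>borel_measurable (F t). AE \<omega> in M. h \<omega> (V \<omega>) =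
    ess_inf M (F t) ((\<lambda>Z. ess_sup M (F t) {\<lambda>\<omega>. J \<omega> (V \<omega>, Z \<omega>)}) ` selections (F t) risky_space) \<omega>)"
  proof (rule F.marginal_integrand)
    show "closed risky_space" by (intro closed_Collect_eq continuous_intros)
    show "risky_space \<noteq> {}" by (auto intro!: exI[of _ 0])
    show "lsc (J \<omega>)" if "\<omega> \<in> space M" for \<omega>
    proof -
      have "lsc (\<lambda>p. (\<lambda>(s, x). ereal (C t s x)) (S t \<omega>, snd p - risky i1 (fst p)))"
        using t by (intro lsc_compose[OF C_lsc] continuous_intros) auto
      moreover have "lsc (\<gamma>' \<omega>)"
        using next_integrand that by (simp add: normal_integrand_def space_F)
      then have "lsc (\<lambda>p. \<gamma>' \<omega> (S (Suc t) \<omega>, snd p))"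
        by (rule lsc_compose) (intro continuous_intros)
      ultimately show ?thesis
        unfolding J_def case_prod_beta by (intro lsc_add) auto
    qed
    fix U V Z A q
    assume h: "\<And>n::nat. U n \<in> borel_measurable (F t)" "V \<in> borel_measurable (F t)"
      "\<And>n. Z n \<in> selections (F t) risky_space" "A \<in> sets (F t)"
      "\<And>\<omega>. \<omega> \<in> A \<Longrightarrow> (\<lambda>n. U n \<omega>) \<longlonglongrightarrow> V \<omega>"
      "\<And>n. AE \<omega> in M. \<omega> \<in> A \<longrightarrow> J \<omega> (U n \<omega>, Z n \<omega>) \<le> ereal q"
    have "AE \<omega> in M. \<omega> \<in> A \<longrightarrow> ereal (C t (S t \<omega>) (Z n \<omega> - risky i1 (U n \<omega>))) +
        hedging_cost \<xi> (Suc t) (Z n) \<omega> \<le> ereal q" for n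
      using h(6)[of n] next_eq[OF h(3), of A n] by eventually_elim (simp add: J_def)
    with t enlarged delta homogeneous \<xi> \<xi>_nonneg C_additive theta positive h(1,3,4,5)
    show "AE \<omega> in M. \<omega> \<in> A \<longrightarrow> bounded (range (\<lambda>n. Z n \<omega>))"
      by (rule hedging_positions_bounded)
  qed
  then obtain h where h: "normal_integrand (F t) h"
    and h_eq: "\<And>V. V \<in> borel_measurable (F t) \<Longrightarrow> AE \<omega> in M. h \<omega> (V \<omega>) =
      ess_inf M (F t) ((\<lambda>Z. ess_sup M (F t) {\<lambda>\<omega>. J \<omega> (V \<omega>, Z \<omega>)}) ` selections (F t) risky_space) \<omega>"
    by blast
  \<comment> \<open>the price vector at time \<open>t\<close> is a function of \<open>\<omega>\<close>, so its influence is already absorbed into \<open>h\<close>\<close>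
  show ?thesis
  proof (intro exI[of _ "\<lambda>\<omega> p. h \<omega> (snd p)"] conjI ballI)
    have [measurable]: "(\<lambda>(\<omega>, v). h \<omega> v) \<in> borel_measurable (F t \<Otimes>\<^sub>M borel)"
      using h by (simp add: normal_integrand_def)
    have "(\<lambda>p. (\<lambda>(\<omega>, v). h \<omega> v) (fst p, snd (snd p))) \<in>
        borel_measurable (F t \<Otimes>\<^sub>M (borel :: ((real^'m) \<times> (real^'d)) measure))"
      unfolding borel_prod[symmetric] by measurable
    moreover have "lsc (\<lambda>p::(real^'m) \<times> (real^'d). h \<omega> (snd p))" if "\<omega> \<in> space (F t)" for \<omega>
    proof (rule lsc_compose[where f="h \<omega>" and k=snd])
      show "lsc (h \<omega>)" using h that by (simp add: normal_integrand_def)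
    qed (intro continuous_intros)
    ultimately show "normal_integrand (F t) (\<lambda>\<omega> p::(real^'m) \<times> (real^'d). h \<omega> (snd p))"
      by (simp add: normal_integrand_def case_prod_beta)
    fix V :: "'a \<Rightarrow> real^'d" assume V: "V \<in> borel_measurable (F t)"
    have "AE \<omega> in M. \<omega> \<in> space (F t) \<longrightarrow>
        ess_inf M (F t) ((\<lambda>Z. ess_sup M (F t) {\<lambda>\<omega>. ereal (C t (S t \<omega>) (Z \<omega> - risky i1 (V \<omega>))) +
          hedging_cost \<xi> (Suc t) Z \<omega>}) ` selections (F t) risky_space) \<omega> =
        ess_inf M (F t) ((\<lambda>Z. ess_sup M (F t) {\<lambda>\<omega>. J \<omega> (V \<omega>, Z \<omega>)}) ` selections (F t) risky_space) \<omega>"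
    proof (intro F.ess_inf_cong_on F.ess_sup_cong_on sets.top)
      fix Z assume "Z \<in> selections (F t) risky_space"
      from next_eq[OF this, of "space (F t)"]
      show "AE \<omega> in M. \<omega> \<in> space (F t) \<longrightarrow> ereal (C t (S t \<omega>) (Z \<omega> - risky i1 (V \<omega>))) +
          hedging_cost \<xi> (Suc t) Z \<omega> = J \<omega> (V \<omega>, Z \<omega>)"
        by eventually_elim (simp add: J_def)
    qed
    with hedging_cost_dynamic_programming[OF t V, of \<xi>] h_eq[OF V] AE_space
    show "AE \<omega> in M. hedging_cost \<xi> t V \<omega> = h \<omega> (snd (S t \<omega>, V \<omega>))"
      by eventually_elim (simp add: space_F)
  qed
qed

end
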